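(* Let $\alpha_i,\beta_i,\gamma_i\in\mathbb{C}$ ($i=0,1,2$) with $(\gamma_1,\gamma_2)\neq(0,0)$ be such that $$f(x_1,x_2)=\left(\alpha_0+\alpha_1x_1+\alpha_2x_2,\ \frac{\beta_0+\beta_1x_1+\beta_2x_2}{\gamma_0+\gamma_1x_1+\gamma_2x_2}\right)$$ is birational, suppose $\beta_1\gamma_2-\beta_2\gamma_1=0$ and $\gamma_1\gamma_2\neq0$, and assume that $f$ has zero algebraic entropy. Then after an affine change of coordinates (and renaming the parameters) $f$ can be written as $$f(x,y)=\left(\alpha_0+\alpha_1x,\ \frac{\beta_0}{x+y}\right),\qquad \alpha_1\neq0 .$$ This map preserves the fibration $V(x,y)=x$, and this fibration is unique. If $m(x):=\alpha_0+\alpha_1x$ is periodic of period $p$, that is, if $\alpha_1^p=1$ for some $p>1$, $\alpha_1\neq1$, then $$W(x,y)=x\cdot m(x)\cdot m(m(x))\cdots m^{p-1}(x)$$ is a first integral of $f(x,y)$. Also, when $\alpha_1=1$ and $\alpha_0=0$, $f$ is integrable.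
   Context: A map $f:\mathbb{C}^2\to\mathbb{C}^2$ with rational components is birational if there exist an algebraic curve $V$ and a rational map $g$ with $f\circ g=g\circ f=\mathrm{id}$ on $\mathbb{C}^2\setminus V$. Let $F:\mathbb{P}^2(\mathbb{C})\to\mathbb{P}^2(\mathbb{C})$ be the extension of $f$ via $(x_1,x_2)\mapsto[1:x_1:x_2]$; $\deg(F^n)$ is the degree of the components of $F^n$ after removing common factors. The dynamical degree is $\delta(F)=\lim_{n\to\infty}(\deg(F^n))^{1/n}$ and the algebraic entropy is $\log\delta(F)$. $m^{j}$ denotes the $j$-th iterate of $m$. A fibration given by a nonconstant rational function $V$ is preserved by (invariant under) $f$ if $f$ maps level curves of $V$ to level curves of $V$, i.e. $V\circ f=\varphi\circ V$ for some Möbius map $\varphi$; uniqueness means that $f$ preserves no other fibration (fibrations being identified when they have the same fibres). A first integral is a nonconstant rational function $W$ with $W\circ f=W$; $f$ is integrable if it has a first integral. *)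

theory Defs
  imports Complex_Main "HOL-Computational_Algebra.Computational_Algebra"
    "HOL-Computational_Algebra.Field_as_Ring"
begin

section \<open>Rational functions and rational maps of the affine plane\<close>

text \<open>
  A polynomial in \<open>x, y\<close> is a \<open>complex poly poly\<close> whose outer variable is \<open>y\<close>.
\<close>

definition eval2 :: "complex poly poly \<Rightarrow> complex \<times> complex \<Rightarrow> complex" where
  "eval2 P z = poly (poly P [:snd z:]) (fst z)"

definition algebraic_curve :: "(complex \<times> complex) set \<Rightarrow> bool" where
  "algebraic_curve C \<longleftrightarrow> (\<exists>P. P \<noteq> 0 \<and> C = {z. eval2 P z = 0})"

definition eq_off_curve :: "(complex \<times> complex \<Rightarrow> 'a) \<Rightarrow> (complex \<times> complex \<Rightarrow> 'a) \<Rightarrow> bool" where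
  "eq_off_curve f g \<longleftrightarrow> (\<exists>C. algebraic_curve C \<and> (\<forall>z. z \<notin> C \<longrightarrow> f z = g z))"

text \<open>
  Rational functions are total functions that take the value \<open>0\<close> where the denominator of the
  chosen quotient vanishes. This happens only on an algebraic curve, so identities between
  rational functions are always stated with \<open>eq_off_curve\<close>.
\<close>

definition rational_fun :: "(complex \<times> complex \<Rightarrow> complex) \<Rightarrow> bool" where
  "rational_fun V \<longleftrightarrow> (\<exists>P Q. Q \<noteq> 0 \<and> (\<forall>z. V z = eval2 P z / eval2 Q z))"

definition nonconst_rational_fun :: "(complex \<times> complex \<Rightarrow> complex) \<Rightarrow> bool" where
  "nonconst_rational_fun V \<longleftrightarrow> rational_fun V \<and> \<not> (\<exists>c. eq_off_curve V (\<lambda>_. c))"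

definition rational_map :: "(complex \<times> complex \<Rightarrow> complex \<times> complex) \<Rightarrow> bool" where
  "rational_map f \<longleftrightarrow> rational_fun (fst \<circ> f) \<and> rational_fun (snd \<circ> f)"

definition birational :: "(complex \<times> complex \<Rightarrow> complex \<times> complex) \<Rightarrow> bool" where
  "birational f \<longleftrightarrow> rational_map f \<and>
     (\<exists>C g. algebraic_curve C \<and> rational_map g \<and> (\<forall>z. z \<notin> C \<longrightarrow> f (g z) = z \<and> g (f z) = z))"

definition affine_change :: "(complex \<times> complex \<Rightarrow> complex \<times> complex) \<Rightarrow> bool" where
  "affine_change h \<longleftrightarrow> (\<exists>a b c d e k. b * k - c * e \<noteq> 0 \<and>
     h = (\<lambda>(x, y). (a + b * x + c * y, d + e * x + k * y)))"

text \<open>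
  The coordinate change \<open>h\<close> turns \<open>f\<close> into \<open>g\<close>, that is, \<open>g = h \<circ> f \<circ> h\<^sup>-\<^sup>1\<close> as rational maps.
\<close>

definition affinely_conjugate_by ::
  "(complex \<times> complex \<Rightarrow> complex \<times> complex) \<Rightarrow>
   (complex \<times> complex \<Rightarrow> complex \<times> complex) \<Rightarrow> (complex \<times> complex \<Rightarrow> complex \<times> complex) \<Rightarrow> bool" where
  "affinely_conjugate_by h f g \<longleftrightarrow> affine_change h \<and> eq_off_curve (h \<circ> f) (g \<circ> h)"

section \<open>Invariant fibrations and first integrals\<close>

definition preserves_fibration ::
  "(complex \<times> complex \<Rightarrow> complex \<times> complex) \<Rightarrow> (complex \<times> complex \<Rightarrow> complex) \<Rightarrow> bool" where
  "preserves_fibration f V \<longleftrightarrow> nonconst_rational_fun V \<and>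
     (\<exists>a b c d. a * d - b * c \<noteq> 0 \<and> eq_off_curve (V \<circ> f) (\<lambda>z. (a * V z + b) / (c * V z + d)))"

text \<open>
  With \<open>V = A / B\<close> in lowest terms, the level curves of \<open>V\<close> (including \<open>V = \<infinity>\<close>) are the zero sets
  of the members \<open>s A + t B\<close> of the pencil, and their irreducible components are given by the
  irreducible factors of these members. The fibres of a fibration are compared through their
  irreducible components: otherwise \<open>x\<close> and \<open>x\<^sup>2\<close>, whose level curves consist of the same lines
  \<open>x = const\<close>, would count as different fibrations.
\<close>

definition fibre_component :: "(complex \<times> complex \<Rightarrow> complex) \<Rightarrow> complex poly poly \<Rightarrow> bool" where
  "fibre_component V P \<longleftrightarrow> irreducible P \<and>
     (\<exists>A B s t. B \<noteq> 0 \<and> coprime A B \<and> eq_off_curve V (\<lambda>z. eval2 A z / eval2 B z) \<and>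
        (s, t) \<noteq> (0, 0) \<and> P dvd smult [:s:] A + smult [:t:] B)"

definition same_fibration ::
  "(complex \<times> complex \<Rightarrow> complex) \<Rightarrow> (complex \<times> complex \<Rightarrow> complex) \<Rightarrow> bool" where
  "same_fibration V W \<longleftrightarrow> (\<forall>P. fibre_component V P \<longleftrightarrow> fibre_component W P)"

definition first_integral ::
  "(complex \<times> complex \<Rightarrow> complex \<times> complex) \<Rightarrow> (complex \<times> complex \<Rightarrow> complex) \<Rightarrow> bool" where
  "first_integral f W \<longleftrightarrow> nonconst_rational_fun W \<and> eq_off_curve (W \<circ> f) W"

definition integrable_map :: "(complex \<times> complex \<Rightarrow> complex \<times> complex) \<Rightarrow> bool" where
  "integrable_map f \<longleftrightarrow> (\<exists>W. first_integral f W)"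

section \<open>Homogeneous maps of the projective plane and algebraic entropy\<close>

text \<open>
  Polynomials in \<open>x\<^sub>0, x\<^sub>1, x\<^sub>2\<close> are nested with \<open>x\<^sub>0\<close> innermost and \<open>x\<^sub>2\<close> outermost. A rational
  self-map of the projective plane is represented by a triple of homogeneous polynomials of the
  same degree.
\<close>

type_synonym poly3 = "complex poly poly poly"
type_synonym hom_map = "poly3 \<times> poly3 \<times> poly3"

definition const3 :: "complex \<Rightarrow> poly3" where
  "const3 c = [:[:[:c:]:]:]"

definition X0 :: poly3 where "X0 = [:[:[:0, 1:]:]:]"
definition X1 :: poly3 where "X1 = [:[:0, 1:]:]"
definition X2 :: poly3 where "X2 = [:0, 1:]"

definition subst3 :: "poly3 \<Rightarrow> hom_map \<Rightarrow> poly3" where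
  "subst3 p G = (case G of (a, b, c) \<Rightarrow>
     poly (map_poly (\<lambda>q. poly (map_poly (\<lambda>r. poly (map_poly const3 r) a) q) b) p) c)"

definition hom_comp :: "hom_map \<Rightarrow> hom_map \<Rightarrow> hom_map" where
  "hom_comp F G = (case F of (F0, F1, F2) \<Rightarrow> (subst3 F0 G, subst3 F1 G, subst3 F2 G))"

definition hom_iter :: "hom_map \<Rightarrow> nat \<Rightarrow> hom_map" where
  "hom_iter F n = (hom_comp F ^^ n) (X0, X1, X2)"

definition total_degree3 :: "poly3 \<Rightarrow> nat" where
  "total_degree3 p = Max (insert 0 {i + j + k | i j k. coeff (coeff (coeff p k) j) i \<noteq> 0})"

definition remove_common_factors :: "hom_map \<Rightarrow> hom_map" where
  "remove_common_factors F = (case F of (F0, F1, F2) \<Rightarrow>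
     let d = gcd F0 (gcd F1 F2) in (F0 div d, F1 div d, F2 div d))"

definition hom_degree :: "hom_map \<Rightarrow> nat" where
  "hom_degree F = (case remove_common_factors F of (G0, G1, G2) \<Rightarrow>
     max (total_degree3 G0) (max (total_degree3 G1) (total_degree3 G2)))"

definition dynamical_degree :: "hom_map \<Rightarrow> real" where
  "dynamical_degree F = lim (\<lambda>n. root n (real (hom_degree (hom_iter F n))))"

definition algebraic_entropy :: "hom_map \<Rightarrow> real" where
  "algebraic_entropy F = ln (dynamical_degree F)"

section \<open>The family and its normal form\<close>

text \<open>Only the values of the parameters \<open>\<alpha>, \<beta>, \<gamma>\<close> at \<open>0, 1, 2\<close> are used.\<close>

definition affine_form :: "(nat \<Rightarrow> complex) \<Rightarrow> complex \<times> complex \<Rightarrow> complex" where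
  "affine_form a = (\<lambda>(x1, x2). a 0 + a 1 * x1 + a 2 * x2)"

definition family_map ::
  "(nat \<Rightarrow> complex) \<Rightarrow> (nat \<Rightarrow> complex) \<Rightarrow> (nat \<Rightarrow> complex) \<Rightarrow> complex \<times> complex \<Rightarrow> complex \<times> complex" where
  "family_map \<alpha> \<beta> \<gamma> z = (affine_form \<alpha> z, affine_form \<beta> z / affine_form \<gamma> z)"

definition hom_form :: "(nat \<Rightarrow> complex) \<Rightarrow> poly3" where
  "hom_form a = const3 (a 0) * X0 + const3 (a 1) * X1 + const3 (a 2) * X2"

definition family_ext :: "(nat \<Rightarrow> complex) \<Rightarrow> (nat \<Rightarrow> complex) \<Rightarrow> (nat \<Rightarrow> complex) \<Rightarrow> hom_map" where
  "family_ext \<alpha> \<beta> \<gamma> = (X0 * hom_form \<gamma>, hom_form \<alpha> * hom_form \<gamma>, X0 * hom_form \<beta>)"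

definition eval3 :: "poly3 \<Rightarrow> complex \<Rightarrow> complex \<Rightarrow> complex \<Rightarrow> complex" where
  "eval3 p x0 x1 x2 = poly (poly (poly p [:[:x2:]:]) [:x1:]) x0"

text \<open>
  In homogeneous coordinates, \<open>family_ext\<close> maps \<open>[1 : x\<^sub>1 : x\<^sub>2]\<close> to \<open>[1 : f (x\<^sub>1, x\<^sub>2)]\<close>.
\<close>

lemma eval3_mult: "eval3 (p * q) x0 x1 x2 = eval3 p x0 x1 x2 * eval3 q x0 x1 x2"
  by (simp add: eval3_def)

lemma eval3_X0: "eval3 X0 x0 x1 x2 = x0"
  by (simp add: eval3_def X0_def)

lemma eval3_hom_form: "eval3 (hom_form a) 1 x1 x2 = affine_form a (x1, x2)"
  by (simp add: eval3_def hom_form_def const3_def X0_def X1_def X2_def affine_form_def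
      algebra_simps)

lemma family_ext_extends:
  assumes "affine_form \<gamma> (x1, x2) \<noteq> 0" and "family_ext \<alpha> \<beta> \<gamma> = (F0, F1, F2)"
  shows "eval3 F0 1 x1 x2 \<noteq> 0"
    and "family_map \<alpha> \<beta> \<gamma> (x1, x2) =
           (eval3 F1 1 x1 x2 / eval3 F0 1 x1 x2, eval3 F2 1 x1 x2 / eval3 F0 1 x1 x2)"
  using assms
  by (auto simp: family_ext_def family_map_def eval3_mult eval3_X0 eval3_hom_form)

definition normal_form :: "complex \<Rightarrow> complex \<Rightarrow> complex \<Rightarrow> complex \<times> complex \<Rightarrow> complex \<times> complex" where
  "normal_form \<alpha>0 \<alpha>1 \<beta>0 = (\<lambda>(x, y). (\<alpha>0 + \<alpha>1 * x, \<beta>0 / (x + y)))"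

end

theory Submission
  imports Defs "HOL-Number_Theory.Fib"
begin

text \<open>
  Since \<open>(\<beta>\<^sub>1, \<beta>\<^sub>2) = l (\<gamma>\<^sub>1, \<gamma>\<^sub>2)\<close>, the second component of the map is
  \<open>l + b / (\<gamma>\<^sub>0 + \<gamma>\<^sub>1 x\<^sub>1 + \<gamma>\<^sub>2 x\<^sub>2)\<close>, and birationality forces \<open>b \<noteq> 0\<close>. Once \<open>\<alpha>\<^sub>2 = 0\<close> is known, the
  normal form is immediate: take \<open>x\<^sub>2 - l\<close> and a suitable affine function of \<open>x\<^sub>1\<close> as new coordinates, and
  \<open>\<alpha>\<^sub>1 \<noteq> 0\<close> because the first component of a birational map is not constant.

  So zero entropy has to give \<open>\<alpha>\<^sub>2 = 0\<close>, and for this the degrees of the iterates are computed exactly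
  when \<open>\<alpha>\<^sub>2 \<noteq> 0\<close>. If also \<open>\<alpha>\<^sub>1 \<noteq> 0\<close>, the map \<open>F\<close> contracts curves only to points of the line at infinity
  that never become indeterminate; no common factor arises and the degree of \<open>F\<^sup>n\<close> is \<open>2\<^sup>n\<close>
  (\<open>hom_degree_doubling\<close>). If \<open>\<alpha>\<^sub>1 = 0\<close>, then \<open>t = \<gamma>\<^sub>0 + \<gamma>\<^sub>1 x\<^sub>1 + \<gamma>\<^sub>2 x\<^sub>2\<close> satisfies a recurrence
  \<open>t\<^sub>n\<^sub>+\<^sub>1 = c + B / t\<^sub>n\<^sub>-\<^sub>1 + A / t\<^sub>n\<close> along orbits. Writing \<open>t\<^sub>n = T\<^sub>n / (T\<^sub>n\<^sub>-\<^sub>1 T\<^sub>n\<^sub>-\<^sub>2)\<close> turns it into a polynomial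
  recurrence whose solutions are coprime at distance one and two, because \<open>A B \<noteq> 0\<close>. This exhibits the
  common factors of the iterates completely, and the degrees are Fibonacci numbers
  (\<open>hom_degree_fibonacci\<close>). In both cases the dynamical degree exceeds \<open>1\<close> (\<open>entropy_nonzero\<close>).

  The fibration \<open>x = const\<close> is unique by a height argument, here for \<open>\<beta>\<^sub>0 \<noteq> 0\<close>. Let \<open>V = A / B\<close> in lowest
  terms be another invariant function and let \<open>k\<close> be its degree in \<open>y\<close>. On each line \<open>x = const\<close> the normal
  form acts by a matrix of constant nonzero determinant, so pulling back and clearing denominators by
  \<open>(x + y)\<^sup>k\<close> introduces no factor in \<open>x\<close>, and the pencil spanned by \<open>A\<close> and \<open>B\<close> is mapped to itself by a
  constant matrix. Follow the orbit \<open>(x\<^sub>n, u\<^sub>n / v\<^sub>n)\<close> of the curve \<open>y = 0\<close>: the polynomials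
  \<open>v\<^sub>n\<^sup>k A(x\<^sub>n, u\<^sub>n / v\<^sub>n)\<close> and \<open>v\<^sub>n\<^sup>k B(x\<^sub>n, u\<^sub>n / v\<^sub>n)\<close> stay in the span of their values for \<open>n = 0\<close>, hence have
  bounded degree in \<open>x\<close>, while \<open>v\<^sub>n\<close> has degree \<open>n\<close>. A Bezout identity \<open>S A + T B = \<rho>(x)\<close> shows that \<open>A\<close> and \<open>B\<close> cannot
  both be that small along the orbit unless \<open>k = 0\<close> (\<open>invariant_pencil_degree_0\<close>). Then \<open>V\<close> depends on \<open>x\<close>
  only, and the components of its fibres are exactly the vertical lines (\<open>same_fibration_vertical\<close>).
\<close>

section \<open>Identities off algebraic curves\<close>

lemma eval2_simps [simp]:
  "eval2 0 z = 0" "eval2 1 z = 1"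
  "eval2 (P + Q) z = eval2 P z + eval2 Q z" "eval2 (P - Q) z = eval2 P z - eval2 Q z"
  "eval2 (P * Q) z = eval2 P z * eval2 Q z" "eval2 (- P) z = - eval2 P z"
  "eval2 [:p:] z = poly p (fst z)"
  "eval2 (smult p P) z = poly p (fst z) * eval2 P z"
  by (simp_all add: eval2_def)

lemma eval2_pCons [simp]: "eval2 (pCons p P) z = poly p (fst z) + snd z * eval2 P z"
  by (simp add: eval2_def)

lemma eval2_eqI:
  assumes "\<And>z. eval2 P z = eval2 Q z"
  shows "P = Q"
proof (rule ccontr)
  assume "P \<noteq> Q"
  hence "finite {u. poly (P - Q) u = 0}"
    by (intro poly_roots_finite) auto
  moreover have "poly (P - Q) [:y:] = 0" for y
  proof -
    have "poly (poly (P - Q) [:y:]) x = 0" for x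
      using assms[of "(x, y)"] by (simp add: eval2_def)
    thus ?thesis
      using poly_all_0_iff_0 by blast
  qed
  hence "range (\<lambda>y. [:y:]) \<subseteq> {u. poly (P - Q) u = 0}"
    by blast
  ultimately have "finite (range (\<lambda>y::complex. [:y:]))"
    by (rule finite_subset[rotated])
  moreover have "inj (\<lambda>y::complex. [:y:])"
    by (simp add: inj_def)
  ultimately show False
    using infinite_UNIV_char_0[where 'a = complex] by (simp add: finite_image_iff)
qed

text \<open>
  The complement of a curve is Zariski dense; this is what turns the identities of rational
  functions below into identities of polynomials.
\<close>

lemma eval2_eqI_off:
  assumes "R \<noteq> 0" and "\<And>z. eval2 R z \<noteq> 0 \<Longrightarrow> eval2 P z = eval2 Q z"
  shows "P = Q"
proof -
  have "(P - Q) * R = 0"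
    by (rule eval2_eqI) (use assms(2) in force)
  thus ?thesis
    using assms(1) by simp
qed

lemma eq_off_curve_iff:
  "eq_off_curve f g \<longleftrightarrow> (\<exists>R. R \<noteq> 0 \<and> (\<forall>z. eval2 R z \<noteq> 0 \<longrightarrow> f z = g z))"
  unfolding eq_off_curve_def algebraic_curve_def by auto

lemma eq_off_curveI:
  assumes "R \<noteq> 0" and "\<And>z. eval2 R z \<noteq> 0 \<Longrightarrow> f z = g z"
  shows "eq_off_curve f g"
  using assms by (auto simp: eq_off_curve_iff)

lemma eq_off_curve_refl: "eq_off_curve f f"
  by (rule eq_off_curveI[of 1]) auto

lemma eq_off_curve_sym: "eq_off_curve f g \<Longrightarrow> eq_off_curve g f"
  by (auto simp: eq_off_curve_iff)

lemma eq_off_curve_trans: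
  assumes "eq_off_curve f g" and "eq_off_curve g h"
  shows "eq_off_curve f h"
proof -
  from assms obtain R S where "R \<noteq> 0" "\<And>z. eval2 R z \<noteq> 0 \<Longrightarrow> f z = g z"
    "S \<noteq> 0" "\<And>z. eval2 S z \<noteq> 0 \<Longrightarrow> g z = h z"
    unfolding eq_off_curve_iff by blast
  thus ?thesis
    by (intro eq_off_curveI[of "R * S"]) auto
qed

lemma quotient_eq_iff:
  assumes "B \<noteq> 0" and "D \<noteq> 0"
  shows "eq_off_curve (\<lambda>z. eval2 A z / eval2 B z) (\<lambda>z. eval2 C z / eval2 D z) \<longleftrightarrow> A * D = C * B"
proof
  assume "eq_off_curve (\<lambda>z. eval2 A z / eval2 B z) (\<lambda>z. eval2 C z / eval2 D z)"
  then obtain R where "R \<noteq> 0"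
    and R: "\<And>z. eval2 R z \<noteq> 0 \<Longrightarrow> eval2 A z / eval2 B z = eval2 C z / eval2 D z"
    unfolding eq_off_curve_iff by blast
  show "A * D = C * B"
  proof (rule eval2_eqI_off[of "R * B * D"])
    fix z assume "eval2 (R * B * D) z \<noteq> 0"
    thus "eval2 (A * D) z = eval2 (C * B) z"
      using R[of z] by (simp add: frac_eq_eq)
  qed (use assms \<open>R \<noteq> 0\<close> in simp)
next
  assume *: "A * D = C * B"
  show "eq_off_curve (\<lambda>z. eval2 A z / eval2 B z) (\<lambda>z. eval2 C z / eval2 D z)"
  proof (rule eq_off_curveI[of "B * D"])
    fix z assume "eval2 (B * D) z \<noteq> 0"
    moreover have "eval2 A z * eval2 D z = eval2 C z * eval2 B z"
      using * by (metis eval2_simps(5))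
    ultimately show "eval2 A z / eval2 B z = eval2 C z / eval2 D z"
      by (auto simp: divide_simps)
  qed (use assms in simp)
qed

lemma rational_fun_lowest_terms:
  assumes "rational_fun V"
  obtains A B where "B \<noteq> 0" "coprime A B" "eq_off_curve V (\<lambda>z. eval2 A z / eval2 B z)"
proof -
  from assms obtain P Q where PQ: "Q \<noteq> 0" "V = (\<lambda>z. eval2 P z / eval2 Q z)"
    unfolding rational_fun_def by blast
  obtain A B where AB: "P = A * gcd P Q" "Q = B * gcd P Q" "coprime A B"
    using PQ(1) gcd_coprime_exists[of P Q] by auto
  have "B \<noteq> 0"
    using AB(2) PQ(1) by auto
  moreover have "P * B = A * Q"
    using AB(1,2) by (metis mult.assoc mult.commute)
  hence "eq_off_curve V (\<lambda>z. eval2 A z / eval2 B z)"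
    unfolding PQ(2) by (subst quotient_eq_iff) (use PQ(1) \<open>B \<noteq> 0\<close> in auto)
  ultimately show thesis
    using that AB(3) by blast
qed

section \<open>Pencils\<close>

lemma pencil_nonzero:
  assumes "B \<noteq> 0" and "\<not> (\<exists>c. eq_off_curve (\<lambda>z. eval2 A z / eval2 B z) (\<lambda>_. c))"
    and "(s, t) \<noteq> (0, 0 :: complex)"
  shows "smult [:s:] A + smult [:t:] B \<noteq> 0"
proof
  assume st: "smult [:s:] A + smult [:t:] B = 0"
  have "s \<noteq> 0"
    using st assms(1,3) by auto
  have "eq_off_curve (\<lambda>z. eval2 A z / eval2 B z) (\<lambda>_. - t / s)"
  proof (rule eq_off_curveI[OF assms(1)])
    fix z assume "eval2 B z \<noteq> 0"
    moreover have "s * eval2 A z + t * eval2 B z = 0"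
      using arg_cong[OF st, of "\<lambda>P. eval2 P z"] by simp
    ultimately show "eval2 A z / eval2 B z = - t / s"
      using \<open>s \<noteq> 0\<close> by (simp add: field_simps add_eq_0_iff)
  qed
  with assms(2) show False
    by blast
qed

text \<open>
  Cramer's rule: two independent members of the pencil spanned by \<open>A\<close> and \<open>B\<close> span the same pencil.
\<close>

lemma pencil_cramer:
  fixes A B :: "'a :: comm_ring_1 poly"
  shows "smult (a * d - b * c) A =
      smult d (smult a A + smult b B) + smult (- b) (smult c A + smult d B)"
    and "smult (a * d - b * c) B =
      smult (- c) (smult a A + smult b B) + smult a (smult c A + smult d B)"
  by (simp_all add: smult_add_right smult_diff_left mult.commute)

lemma coprime_pencil:
  fixes A B :: "complex poly poly"
  assumes "coprime A B" and "a * d - b * c \<noteq> 0"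
  shows "coprime (smult [:a:] A + smult [:b:] B) (smult [:c:] A + smult [:d:] B)"
proof (rule coprimeI)
  fix D assume D: "D dvd smult [:a:] A + smult [:b:] B" "D dvd smult [:c:] A + smult [:d:] B"
  let ?\<Delta> = "a * d - b * c"
  have \<Delta>: "[:?\<Delta>:] = [:a:] * [:d:] - [:b:] * [:c:]"
    by simp
  have "D dvd smult [:?\<Delta>:] A" "D dvd smult [:?\<Delta>:] B"
    unfolding \<Delta> pencil_cramer(1)[of _ _ _ _ A B] pencil_cramer(2)[of _ _ _ _ B A]
    using D by (simp_all only: dvd_add dvd_smult)
  moreover have "X = smult [:1 / ?\<Delta>:] (smult [:?\<Delta>:] X)" for X :: "complex poly poly"
    using assms(2) by (simp add: one_pCons[symmetric])
  ultimately have "D dvd A" "D dvd B"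
    by (metis dvd_smult)+
  with assms(1) show "D dvd 1"
    by (meson coprime_common_divisor)
qed

lemma degree_pencil:
  fixes A B :: "complex poly poly"
  assumes "a * d - b * c \<noteq> 0"
  shows "max (degree (smult [:a:] A + smult [:b:] B)) (degree (smult [:c:] A + smult [:d:] B)) =
           max (degree A) (degree B)"
proof (rule antisym)
  have le: "degree (smult [:s:] P + smult [:t:] Q) \<le> max (degree P) (degree Q)"
    for s t :: complex and P Q
    by (meson degree_add_le_max degree_smult_le max.mono order.trans)
  show "max (degree (smult [:a:] A + smult [:b:] B)) (degree (smult [:c:] A + smult [:d:] B)) \<le>
      max (degree A) (degree B)"
    using le by (simp del: degree_smult_eq)
  let ?\<Delta> = "a * d - b * c"
  let ?P = "smult [:a:] A + smult [:b:] B" and ?Q = "smult [:c:] A + smult [:d:] B"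
  have \<Delta>: "[:?\<Delta>:] = [:a:] * [:d:] - [:b:] * [:c:]"
    by simp
  have "smult [:?\<Delta>:] A = smult [:d:] ?P + smult (- [:b:]) ?Q"
    "smult [:?\<Delta>:] B = smult (- [:c:]) ?P + smult [:a:] ?Q"
    unfolding \<Delta> by (rule pencil_cramer)+
  moreover have "degree (smult [:?\<Delta>:] A) = degree A" "degree (smult [:?\<Delta>:] B) = degree B"
    using assms by (simp_all only: degree_smult_eq) auto
  ultimately show "max (degree A) (degree B) \<le> max (degree ?P) (degree ?Q)"
    using le[of d ?P "- b" ?Q] le[of "- c" ?P a ?Q] by (simp del: smult_add_right degree_smult_eq)
qed

section \<open>The fibration by vertical lines\<close>

text \<open>
  A member \<open>s a + t b\<close> of a pencil in \<open>x\<close> alone is a nonzero polynomial in \<open>x\<close>, so its irreducible factors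
  define vertical lines. Conversely the line \<open>x = e\<close> lies in the member with \<open>(s, t) = (b(e), - a(e))\<close>,
  which is not \<open>(0, 0)\<close> by coprimality. So the set of components does not depend on \<open>V\<close>.
\<close>

lemma fibre_component_vertical:
  assumes V: "eq_off_curve V (\<lambda>z. eval2 [:a:] z / eval2 [:b:] z)"
    and b: "b \<noteq> 0" and cop: "coprime a b"
    and nc: "\<not> (\<exists>c. eq_off_curve V (\<lambda>_. c))"
  shows "fibre_component V P \<longleftrightarrow> (\<exists>p. irreducible p \<and> P = [:p:])"
proof
  assume "fibre_component V P"
  then obtain A B s t where irr: "irreducible P"
    and AB: "B \<noteq> 0" "coprime A B" "eq_off_curve V (\<lambda>z. eval2 A z / eval2 B z)"
    and st: "(s, t) \<noteq> (0, 0)" "P dvd smult [:s:] A + smult [:t:] B"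
    unfolding fibre_component_def by blast
  have "eq_off_curve (\<lambda>z. eval2 A z / eval2 B z) (\<lambda>z. eval2 [:a:] z / eval2 [:b:] z)"
    using AB(3) V eq_off_curve_sym eq_off_curve_trans by blast
  hence eq: "A * [:b:] = [:a:] * B"
    using quotient_eq_iff[of B "[:b:]" A "[:a:]"] AB(1) b by (metis pCons_eq_0_iff)
  hence "B dvd A * [:b:]"
    by (metis dvd_triv_right)
  hence "B dvd [:b:]"
    using AB(2) by (metis coprime_commute coprime_dvd_mult_right_iff)
  then obtain C where C: "[:b:] = B * C"
    by (elim dvdE)
  have "A * C = [:a:]"
    using eq AB(1) unfolding C by (metis mult.assoc mult.commute mult_left_cancel)
  moreover have "C * (smult [:s:] A + smult [:t:] B) = smult [:s:] (A * C) + smult [:t:] (B * C)"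
    by (simp add: algebra_simps)
  ultimately have "C * (smult [:s:] A + smult [:t:] B) = smult [:s:] [:a:] + smult [:t:] [:b:]"
    using C by presburger
  hence "C * (smult [:s:] A + smult [:t:] B) = [:smult s a + smult t b:]"
    by simp
  hence "P dvd [:smult s a + smult t b:]"
    using st(2) by (metis dvd_mult)
  moreover have "smult s a + smult t b \<noteq> 0"
  proof -
    have "\<not> (\<exists>c. eq_off_curve (\<lambda>z. eval2 [:a:] z / eval2 [:b:] z) (\<lambda>_. c))"
      using V nc eq_off_curve_trans by blast
    from pencil_nonzero[OF _ this st(1)] b show ?thesis
      by simp
  qed
  ultimately have "degree P \<le> 0"
    by (metis degree_pCons_0 dvd_imp_degree_le pCons_eq_0_iff)
  then obtain p where "P = [:p:]"
    by (metis degree_eq_zeroE le_zero_eq)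
  with irr show "\<exists>p. irreducible p \<and> P = [:p:]"
    by (auto simp: irreducible_const_poly_iff)
next
  assume "\<exists>p. irreducible p \<and> P = [:p:]"
  then obtain p where p: "irreducible p" "P = [:p:]"
    by blast
  \<comment> \<open>\<open>p\<close> is linear because \<open>\<complex>\<close> is algebraically closed.\<close>
  have "\<not> constant (poly p)"
    using p(1) by (auto simp: constant_degree irreducible_def is_unit_iff_degree)
  then obtain e where e: "poly p e = 0"
    using fundamental_theorem_of_algebra by blast
  hence "[:- e, 1:] dvd p"
    by (simp add: poly_eq_0_iff_dvd)
  then obtain q where q: "p = [:- e, 1:] * q"
    by (elim dvdE)
  with p(1) have "is_unit q"
    by (auto dest!: irreducibleD simp: is_unit_iff_degree simp del: mult_pCons_left)
  hence "p dvd [:- e, 1:]"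
    unfolding q by (simp add: mult_unit_dvd_iff del: mult_pCons_left)
  moreover have "[:- e, 1:] dvd smult (poly b e) a + smult (- poly a e) b"
    by (simp add: poly_eq_0_iff_dvd[symmetric])
  ultimately have "p dvd smult (poly b e) a + smult (- poly a e) b"
    by (rule dvd_trans)
  hence "P dvd smult [:poly b e:] [:a:] + smult [:- poly a e:] [:b:]"
    unfolding p(2) by simp
  moreover have "(poly b e, - poly a e) \<noteq> (0, 0)"
  proof
    assume "(poly b e, - poly a e) = (0, 0)"
    hence "[:- e, 1:] dvd a" "[:- e, 1:] dvd b"
      by (auto simp: poly_eq_0_iff_dvd)
    with cop have "[:- e, 1:] dvd 1"
      by (meson coprime_common_divisor)
    thus False
      by (simp add: is_unit_iff_degree)
  qed
  moreover have "coprime [:a:] [:b:]"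
  proof (rule coprimeI)
    fix D assume D: "D dvd [:a:]" "D dvd [:b:]"
    have "degree D \<le> 0"
      using D(2) b by (metis degree_pCons_0 dvd_imp_degree_le pCons_eq_0_iff)
    then obtain d where "D = [:d:]"
      by (metis degree_eq_zeroE le_zero_eq)
    with D cop show "D dvd 1"
      by (auto simp: is_unit_const_poly_iff dest: coprime_common_divisor)
  qed
  moreover have "irreducible P"
    using p by (simp add: irreducible_const_poly_iff)
  ultimately show "fibre_component V P"
    unfolding fibre_component_def using V b by (metis pCons_eq_0_iff)
qed

lemma nonconst_vertical:
  assumes "degree q > 0"
  shows "nonconst_rational_fun (\<lambda>(x, y). poly q x)"
proof -
  have "\<not> eq_off_curve (\<lambda>(x, y). poly q x) (\<lambda>_. c)" for c
  proof
    assume "eq_off_curve (\<lambda>(x, y). poly q x) (\<lambda>_. c)"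
    then obtain R where "R \<noteq> 0" "\<And>z. eval2 R z \<noteq> 0 \<Longrightarrow> poly q (fst z) = c"
      unfolding eq_off_curve_iff case_prod_beta by blast
    hence "[:q:] = [:[:c:]:]"
      by (intro eval2_eqI_off[of R]) auto
    with assms show False
      by simp
  qed
  moreover have "rational_fun (\<lambda>(x, y). poly q x)"
    unfolding rational_fun_def by (rule exI[of _ "[:q:]"], rule exI[of _ 1]) auto
  ultimately show ?thesis
    unfolding nonconst_rational_fun_def by blast
qed

lemma same_fibration_vertical:
  assumes V: "eq_off_curve V (\<lambda>z. eval2 [:a:] z / eval2 [:b:] z)"
    and b: "b \<noteq> 0" and cop: "coprime a b"
    and nc: "nonconst_rational_fun V"
  shows "same_fibration V (\<lambda>(x, y). x)"
proof -
  have "nonconst_rational_fun (\<lambda>(x, y). x)"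
    using nonconst_vertical[of "[:0, 1:]"] by simp
  moreover have "eq_off_curve (\<lambda>(x, y). x) (\<lambda>z. eval2 [:[:0, 1:]:] z / eval2 [:1:] z)"
    by (rule eq_off_curveI[of 1]) auto
  ultimately have "fibre_component (\<lambda>(x, y). x) P \<longleftrightarrow> (\<exists>p. irreducible p \<and> P = [:p:])" for P
    by (intro fibre_component_vertical[where a = "[:0, 1:]" and b = 1])
      (simp_all add: nonconst_rational_fun_def)
  moreover have "fibre_component V P \<longleftrightarrow> (\<exists>p. irreducible p \<and> P = [:p:])" for P
    using assms by (intro fibre_component_vertical) (auto simp: nonconst_rational_fun_def)
  ultimately show ?thesis
    unfolding same_fibration_def by blast
qed

section \<open>Bezout identities over a polynomial ring\<close>

text \<open>
  The Euclidean algorithm with pseudo-division: each step multiplies by a nonzero element of the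
  coefficient ring, and \<open>\<rho>\<close> collects these multipliers.
\<close>

lemma bezout_up_to_constant:
  fixes A B :: "'a :: idom poly"
  shows "\<exists>S T \<rho>. \<rho> \<noteq> 0 \<and> S * A + T * B dvd smult \<rho> A \<and> S * A + T * B dvd smult \<rho> B"
proof (induction "if B = 0 then 0 else Suc (degree B)" arbitrary: A B rule: less_induct)
  case less
  show ?case
  proof (cases "B = 0")
    case True
    show ?thesis
      by (rule exI[of _ 1], rule exI[of _ 0], rule exI[of _ 1]) (use True in auto)
  next
    case False
    obtain a q where a: "a \<noteq> 0" "smult a A = B * q + pseudo_mod A B"
      using pseudo_mod(1)[OF False, of A] by blast
    define r where "r = pseudo_mod A B"
    have "r = 0 \<or> degree r < degree B"
      unfolding r_def using pseudo_mod(2)[OF False, of A] by blast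
    with False have "(if r = 0 then 0 else Suc (degree r)) < (if B = 0 then 0 else Suc (degree B))"
      by auto
    from less[OF this, of B] obtain S T \<rho> where \<rho>: "\<rho> \<noteq> 0"
      and d: "S * B + T * r dvd smult \<rho> B" "S * B + T * r dvd smult \<rho> r"
      by blast
    have r: "r = smult a A - B * q"
      using a(2) by (simp add: r_def)
    have eq: "smult a T * A + (S - T * q) * B = S * B + T * r"
      unfolding r by (simp add: algebra_simps)
    have "smult (a * \<rho>) A = smult \<rho> B * q + smult \<rho> r"
      unfolding r by (simp add: algebra_simps smult_diff_right)
    moreover have "S * B + T * r dvd smult \<rho> B * q + smult \<rho> r"
      using d by (intro dvd_add dvd_mult2)
    ultimately have "S * B + T * r dvd smult (a * \<rho>) A"
      by (simp only:)
    moreover have "S * B + T * r dvd smult (a * \<rho>) B"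
      using dvd_smult[OF d(1), of a] by simp
    ultimately show ?thesis
      using a(1) \<rho> eq by (metis no_zero_divisors)
  qed
qed

lemma coprime_bezout:
  fixes A B :: "complex poly poly"
  assumes "coprime A B"
  obtains S T \<rho> where "\<rho> \<noteq> 0" "S * A + T * B = [:\<rho>:]"
proof -
  obtain S T \<rho> where \<rho>: "\<rho> \<noteq> 0"
    and "S * A + T * B dvd smult \<rho> A" "S * A + T * B dvd smult \<rho> B"
    using bezout_up_to_constant by metis
  hence "S * A + T * B dvd gcd ([:\<rho>:] * A) ([:\<rho>:] * B)"
    by simp
  hence "S * A + T * B dvd [:\<rho>:]"
    using assms by (simp only: gcd_mult_left coprime_imp_gcd_eq_1) (simp add: dvd_normalize_iff)
  then obtain W where "[:\<rho>:] = (S * A + T * B) * W"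
    by (elim dvdE)
  hence "(W * S) * A + (W * T) * B = [:\<rho>:]"
    by (simp add: algebra_simps)
  with \<rho> that show thesis
    by blast
qed

section \<open>Pulling polynomials back along the normal form\<close>

text \<open>
  The value at \<open>(u : v)\<close> of the form of degree \<open>k\<close> in two variables obtained by homogenizing \<open>G\<close> with
  respect to \<open>y\<close>.
\<close>

definition hom_eval :: "nat \<Rightarrow> complex poly poly \<Rightarrow> complex \<Rightarrow> complex \<Rightarrow> complex \<Rightarrow> complex" where
  "hom_eval k G x u v = (\<Sum>j\<le>k. poly (coeff G j) x * u ^ j * v ^ (k - j))"

definition hom_eval_poly ::
  "nat \<Rightarrow> complex poly poly \<Rightarrow> complex poly \<Rightarrow> complex poly \<Rightarrow> complex poly \<Rightarrow> complex poly" where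
  "hom_eval_poly k G X U V = (\<Sum>j\<le>k. pcompose (coeff G j) X * U ^ j * V ^ (k - j))"

text \<open>
  The numerator of \<open>G\<close> composed with the normal form, namely \<open>(x + y)\<^sup>k G(\<alpha>\<^sub>0 + \<alpha>\<^sub>1 x, \<beta>\<^sub>0 / (x + y))\<close>.
\<close>

definition pullback :: "complex \<Rightarrow> complex \<Rightarrow> complex \<Rightarrow> nat \<Rightarrow> complex poly poly \<Rightarrow> complex poly poly" where
  "pullback \<alpha>0 \<alpha>1 \<beta>0 k G =
     (\<Sum>j\<le>k. [:smult (\<beta>0 ^ j) (pcompose (coeff G j) [:\<alpha>0, \<alpha>1:]):] * [:[:0, 1:], 1:] ^ (k - j))"

lemma eval2_altdef:
  assumes "degree G \<le> k"
  shows "eval2 G (x, y) = (\<Sum>j\<le>k. poly (coeff G j) x * y ^ j)"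
proof -
  have "poly G [:y:] = (\<Sum>j\<le>k. coeff G j * [:y:] ^ j)"
    unfolding poly_altdef using assms
    by (intro sum.mono_neutral_left) (auto simp: coeff_eq_0 not_le)
  thus ?thesis
    by (simp add: eval2_def poly_sum poly_power)
qed

lemma eval2_sum: "eval2 (\<Sum>j\<in>I. P j) z = (\<Sum>j\<in>I. eval2 (P j) z)"
  by (induction I rule: infinite_finite_induct) auto

lemma eval2_power: "eval2 (P ^ n) z = eval2 P z ^ n"
  by (induction n) auto

lemma hom_eval_eq_eval2:
  assumes "degree G \<le> k" and "v \<noteq> 0"
  shows "hom_eval k G x u v = v ^ k * eval2 G (x, u / v)"
proof -
  have "v ^ k * (u / v) ^ j = u ^ j * v ^ (k - j)" if "j \<le> k" for j
    using assms(2) that by (simp add: power_divide power_diff)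
  thus ?thesis
    unfolding hom_eval_def eval2_altdef[OF assms(1)] sum_distrib_left
    by (intro sum.cong) (auto simp: mult_ac)
qed

lemma eval2_pullback:
  "eval2 (pullback \<alpha>0 \<alpha>1 \<beta>0 k G) (x, y) = hom_eval k G (\<alpha>0 + \<alpha>1 * x) \<beta>0 (x + y)"
  unfolding pullback_def hom_eval_def eval2_sum
  by (intro sum.cong) (simp_all add: eval2_power poly_pcompose mult_ac)

lemma eval2_pullback_normal_form:
  assumes "degree G \<le> k" and "x + y \<noteq> 0"
  shows "eval2 (pullback \<alpha>0 \<alpha>1 \<beta>0 k G) (x, y) =
           (x + y) ^ k * eval2 G (normal_form \<alpha>0 \<alpha>1 \<beta>0 (x, y))"
  using hom_eval_eq_eval2[OF assms] by (simp add: eval2_pullback normal_form_def)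

lemma degree_pullback: "degree (pullback \<alpha>0 \<alpha>1 \<beta>0 k G) \<le> k"
  unfolding pullback_def
proof (intro degree_sum_le)
  fix j assume "j \<in> {..k}"
  have "degree ([:smult (\<beta>0 ^ j) (pcompose (coeff G j) [:\<alpha>0, \<alpha>1:]):] * [:[:0, 1:], 1:] ^ (k - j))
      \<le> 0 + degree ([:[:0, 1:], 1 :: complex poly:] ^ (k - j))"
    by (rule order.trans[OF degree_mult_le]) simp
  also have "\<dots> \<le> k"
    using degree_power_le[of "[:[:0, 1:], 1 :: complex poly:]" "k - j"] by simp
  finally show "degree ([:smult (\<beta>0 ^ j) (pcompose (coeff G j) [:\<alpha>0, \<alpha>1:]):] *
      [:[:0, 1:], 1:] ^ (k - j)) \<le> k" .
qed simp

text \<open>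
  For fixed \<open>x = e\<close> the pullback is a polynomial in \<open>w = e + y\<close> whose coefficients are, up to powers of
  \<open>\<beta>\<^sub>0\<close>, those of \<open>G\<close> at \<open>\<alpha>\<^sub>0 + \<alpha>\<^sub>1 e\<close> in reverse order. So the pullback can vanish on a vertical line only
  if \<open>G\<close> vanishes on the image line.
\<close>

lemma pullback_vanishing_line:
  assumes "\<beta>0 \<noteq> 0" and "\<And>y. eval2 (pullback \<alpha>0 \<alpha>1 \<beta>0 k G) (e, y) = 0" and "j \<le> k"
  shows "poly (coeff G j) (\<alpha>0 + \<alpha>1 * e) = 0"
proof -
  define c where "c = (\<lambda>j. poly (coeff G j) (\<alpha>0 + \<alpha>1 * e) * \<beta>0 ^ j)"
  have "(\<Sum>i\<le>k. c (k - i) * w ^ i) = 0" for w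
  proof -
    have "(\<Sum>i\<le>k. c (k - i) * w ^ i) = (\<Sum>j\<le>k. c j * w ^ (k - j))"
      by (rule sum.reindex_bij_witness[of _ "\<lambda>j. k - j" "\<lambda>j. k - j"]) auto
    also have "\<dots> = 0"
      using assms(2)[of "w - e"] by (simp add: eval2_pullback hom_eval_def c_def)
    finally show ?thesis .
  qed
  hence "c (k - (k - j)) = 0"
    using polyfun_eq_0[of "\<lambda>i. c (k - i)" k] by auto
  with assms(1,3) show ?thesis
    by (simp add: c_def)
qed

lemma pullback_eq_0_iff:
  assumes "\<alpha>1 \<noteq> 0" and "\<beta>0 \<noteq> 0" and "degree G \<le> k"
  shows "pullback \<alpha>0 \<alpha>1 \<beta>0 k G = 0 \<longleftrightarrow> G = 0"
proof
  assume 0: "pullback \<alpha>0 \<alpha>1 \<beta>0 k G = 0"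
  have "poly (coeff G j) x = 0" for j x
  proof (cases "j \<le> k")
    case True
    have "poly (coeff G j) (\<alpha>0 + \<alpha>1 * ((x - \<alpha>0) / \<alpha>1)) = 0"
      using assms(2) 0 True by (intro pullback_vanishing_line) auto
    thus ?thesis
      using assms(1) by simp
  next
    case False
    thus ?thesis
      using assms(3) by (simp add: coeff_eq_0)
  qed
  hence "coeff G j = 0" for j
    using poly_all_0_iff_0 by blast
  thus "G = 0"
    by (intro poly_eqI) simp
qed (simp add: pullback_def)

section \<open>Pencils invariant under the pullback\<close>

text \<open>
  The images of the curve \<open>y = 0\<close>: the \<open>n\<close>-th one is parametrized by \<open>t \<mapsto> (X(t), U(t) / V(t))\<close>.
\<close>

fun orbit :: "complex \<Rightarrow> complex \<Rightarrow> complex \<Rightarrow> nat \<Rightarrow> complex poly \<times> complex poly \<times> complex poly" where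
  "orbit \<alpha>0 \<alpha>1 \<beta>0 0 = ([:0, 1:], 0, 1)"
| "orbit \<alpha>0 \<alpha>1 \<beta>0 (Suc n) =
     (case orbit \<alpha>0 \<alpha>1 \<beta>0 n of (X, U, V) \<Rightarrow> ([:\<alpha>0:] + smult \<alpha>1 X, smult \<beta>0 V, U + X * V))"

text \<open>
  The recurrence \<open>V\<^sub>n\<^sub>+\<^sub>1 = U\<^sub>n + X\<^sub>n V\<^sub>n\<close> raises the degree of \<open>V\<close> by one each time since \<open>\<alpha>\<^sub>1 \<noteq> 0\<close> keeps
  \<open>X\<^sub>n\<close> linear. This linear growth is what rules out a second invariant fibration.
\<close>

lemma orbit_degrees:
  assumes "\<alpha>1 \<noteq> 0" and "orbit \<alpha>0 \<alpha>1 \<beta>0 n = (X, U, V)"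
  shows "degree X = 1 \<and> degree U \<le> n \<and> degree V = n \<and> V \<noteq> 0"
  using assms(2)
proof (induction n arbitrary: X U V)
  case (Suc n)
  obtain X' U' V' where *: "orbit \<alpha>0 \<alpha>1 \<beta>0 n = (X', U', V')"
    by (metis prod.exhaust)
  note IH = Suc.IH[OF *]
  have eqs: "X = [:\<alpha>0:] + smult \<alpha>1 X'" "U = smult \<beta>0 V'" "V = U' + X' * V'"
    using Suc.prems * by auto
  have "degree X = 1"
    unfolding eqs using IH assms(1) by (subst degree_add_eq_right) auto
  moreover have deg: "degree (X' * V') = Suc n"
    using IH by (subst degree_mult_eq) auto
  hence "degree V = Suc n"
    unfolding eqs using IH by (subst degree_add_eq_right) auto
  moreover have "degree U \<le> Suc n"
    unfolding eqs using IH degree_smult_le[of \<beta>0 V'] by simp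
  ultimately show ?case
    by auto
qed auto

lemma poly_hom_eval_poly:
  "poly (hom_eval_poly k G X U V) t = hom_eval k G (poly X t) (poly U t) (poly V t)"
  by (simp add: hom_eval_poly_def hom_eval_def poly_sum poly_pcompose poly_power)

lemma poly_eqI_off:
  fixes p q r :: "complex poly"
  assumes "r \<noteq> 0" and "\<And>t. poly r t \<noteq> 0 \<Longrightarrow> poly p t = poly q t"
  shows "p = q"
proof -
  have "poly ((p - q) * r) t = 0" for t
    using assms(2)[of t] by (cases "poly r t = 0") auto
  hence "(p - q) * r = 0"
    using poly_all_0_iff_0 by blast
  thus ?thesis
    using assms(1) by simp
qed

text \<open>
  Evaluating on the next curve of the orbit is the same as evaluating the pullback on the present
  one; the homogenized form makes this an identity of polynomials without denominators.
\<close>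

lemma hom_eval_orbit_Suc:
  assumes "\<alpha>1 \<noteq> 0" and "degree G \<le> k"
    and "orbit \<alpha>0 \<alpha>1 \<beta>0 n = (X, U, V)" and "orbit \<alpha>0 \<alpha>1 \<beta>0 (Suc n) = (X', U', V')"
  shows "hom_eval_poly k G X' U' V' = hom_eval_poly k (pullback \<alpha>0 \<alpha>1 \<beta>0 k G) X U V"
proof (rule poly_eqI_off[of "V * V'"])
  show "V * V' \<noteq> 0"
    using orbit_degrees[OF assms(1,3)] orbit_degrees[OF assms(1,4)] by simp
next
  fix t assume "poly (V * V') t \<noteq> 0"
  hence nz: "poly V t \<noteq> 0" "poly V' t \<noteq> 0"
    by auto
  define x u v where "x = poly X t" and "u = poly U t" and "v = poly V t"
  have eqs: "poly X' t = \<alpha>0 + \<alpha>1 * x" "poly U' t = \<beta>0 * v" "poly V' t = u + x * v"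
    using assms(3,4) by (auto simp: x_def u_def v_def)
  have v: "v \<noteq> 0" "u + x * v \<noteq> 0"
    using nz eqs by (auto simp: v_def)
  have w: "x + u / v = (u + x * v) / v"
    using v(1) by (simp add: add_divide_distrib)
  hence xy: "x + u / v \<noteq> 0"
    using v by (metis divide_eq_0_iff)
  have "hom_eval k (pullback \<alpha>0 \<alpha>1 \<beta>0 k G) x u v =
      v ^ k * eval2 (pullback \<alpha>0 \<alpha>1 \<beta>0 k G) (x, u / v)"
    by (rule hom_eval_eq_eval2[OF degree_pullback v(1)])
  also have "\<dots> = (v * (x + u / v)) ^ k * eval2 G (\<alpha>0 + \<alpha>1 * x, \<beta>0 / (x + u / v))"
    using eval2_pullback_normal_form[OF assms(2) xy]
    by (simp add: normal_form_def power_mult_distrib)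
  also have "v * (x + u / v) = u + x * v"
    unfolding w using v by (metis nonzero_mult_div_cancel_left times_divide_eq_right)
  also have "\<beta>0 / (x + u / v) = (\<beta>0 * v) / (u + x * v)"
    unfolding w by (metis divide_divide_eq_right)
  also have "(u + x * v) ^ k * eval2 G (\<alpha>0 + \<alpha>1 * x, (\<beta>0 * v) / (u + x * v)) =
      hom_eval k G (\<alpha>0 + \<alpha>1 * x) (\<beta>0 * v) (u + x * v)"
    by (rule hom_eval_eq_eval2[OF assms(2) v(2), symmetric])
  finally show "poly (hom_eval_poly k G X' U' V') t =
      poly (hom_eval_poly k (pullback \<alpha>0 \<alpha>1 \<beta>0 k G) X U V) t"
    by (simp add: poly_hom_eval_poly eqs x_def u_def v_def)
qed

lemma degree_hom_eval_poly:
  assumes "degree X \<le> 1" "degree U \<le> n" "degree V \<le> n"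
    and "\<And>j. degree (coeff G j) \<le> d"
  shows "degree (hom_eval_poly k G X U V) \<le> d + k * n"
  unfolding hom_eval_poly_def
proof (intro degree_sum_le)
  fix j assume j: "j \<in> {..k}"
  have "degree (pcompose (coeff G j) X) \<le> d * 1"
    using assms(1,4) by (intro order.trans[OF degree_pcompose_le] mult_mono) auto
  moreover have "degree (U ^ j) \<le> n * j"
    using assms(2) by (intro order.trans[OF degree_power_le] mult_mono) auto
  moreover have "degree (V ^ (k - j)) \<le> n * (k - j)"
    using assms(3) by (intro order.trans[OF degree_power_le] mult_mono) auto
  moreover have "n * j + n * (k - j) = k * n"
    using j by (metis atMost_iff distrib_left le_add_diff_inverse mult.commute)
  ultimately show "degree (pcompose (coeff G j) X * U ^ j * V ^ (k - j)) \<le> d + k * n"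
    using degree_mult_le[of "pcompose (coeff G j) X * U ^ j" "V ^ (k - j)"]
      degree_mult_le[of "pcompose (coeff G j) X" "U ^ j"] by linarith
qed simp

lemma coeff_degrees_bounded: obtains d where "\<And>j. degree (coeff (G :: complex poly poly) j) \<le> d"
proof (rule that)
  fix j
  show "degree (coeff G j) \<le> Max ((\<lambda>j. degree (coeff G j)) ` {..Suc (degree G)})"
  proof (cases "j \<le> degree G")
    case True
    thus ?thesis
      by (intro Max_ge) auto
  next
    case False
    thus ?thesis
      by (simp add: coeff_eq_0)
  qed
qed

lemma smult_sum_distrib: "smult c (\<Sum>i\<in>I. f i) = (\<Sum>i\<in>I. smult c (f i))"
  by (induction I rule: infinite_finite_induct) (auto simp: smult_add_right)

lemma hom_eval_poly_pencil:
  assumes "degree A \<le> k" "degree B \<le> k"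
  shows "hom_eval_poly k (smult [:a:] A + smult [:b:] B) X U V =
           smult a (hom_eval_poly k A X U V) + smult b (hom_eval_poly k B X U V)"
  unfolding hom_eval_poly_def
  by (simp add: pcompose_add pcompose_smult algebra_simps sum.distrib smult_sum_distrib)

text \<open>
  Along the orbit the two forms are transformed by a fixed matrix of constants, so their degrees stay
  below some \<open>D\<close>. In the Bezout identity \<open>S A + T B = \<rho>\<close>, homogenized in degree \<open>k + l\<close> and evaluated on the
  orbit, the right-hand side has degree at least \<open>(k + l) n\<close>, but \<open>S\<close> and \<open>T\<close> have degree at most
  \<open>l n + O(1)\<close>. Hence \<open>k n\<close> is bounded in \<open>n\<close>.
\<close>

lemma invariant_pencil_degree_0:
  assumes nz: "\<alpha>1 \<noteq> 0" and cop: "coprime A B" and deg: "degree A \<le> k" "degree B \<le> k"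
    and A: "pullback \<alpha>0 \<alpha>1 \<beta>0 k A = smult [:a:] A + smult [:b:] B"
    and B: "pullback \<alpha>0 \<alpha>1 \<beta>0 k B = smult [:c:] A + smult [:d:] B"
  shows "k = 0"
proof (rule ccontr)
  assume "k \<noteq> 0"
  define H where "H = (\<lambda>G n. case orbit \<alpha>0 \<alpha>1 \<beta>0 n of (X, U, V) \<Rightarrow> hom_eval_poly k G X U V)"
  define D where "D = max (degree (H A 0)) (degree (H B 0))"
  have step: "H A (Suc n) = smult a (H A n) + smult b (H B n)"
    "H B (Suc n) = smult c (H A n) + smult d (H B n)" for n
  proof -
    obtain X U V where o: "orbit \<alpha>0 \<alpha>1 \<beta>0 n = (X, U, V)"
      by (metis prod.exhaust)
    obtain X' U' V' where o': "orbit \<alpha>0 \<alpha>1 \<beta>0 (Suc n) = (X', U', V')"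
      by (metis prod.exhaust)
    show "H A (Suc n) = smult a (H A n) + smult b (H B n)"
      using hom_eval_orbit_Suc[OF nz deg(1) o o'] hom_eval_poly_pencil[OF deg]
      unfolding H_def o o' A by simp
    show "H B (Suc n) = smult c (H A n) + smult d (H B n)"
      using hom_eval_orbit_Suc[OF nz deg(2) o o'] hom_eval_poly_pencil[OF deg]
      unfolding H_def o o' B by simp
  qed
  have HD: "degree (H A n) \<le> D \<and> degree (H B n) \<le> D" for n
  proof (induction n)
    case (Suc n)
    thus ?case
      unfolding step by (intro conjI degree_add_le order.trans[OF degree_smult_le]) auto
  qed (auto simp: D_def)
  obtain S T \<rho> where \<rho>: "\<rho> \<noteq> 0" "S * A + T * B = [:\<rho>:]"
    using coprime_bezout[OF cop] by blast
  define l where "l = max (degree S) (degree T)"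
  obtain dS where dS: "\<And>j. degree (coeff S j) \<le> dS"
    using coeff_degrees_bounded by blast
  obtain dT where dT: "\<And>j. degree (coeff T j) \<le> dT"
    using coeff_degrees_bounded by blast
  have bound: "(k + l) * n \<le> dS + dT + l * n + D" for n
  proof -
    obtain X U V where o: "orbit \<alpha>0 \<alpha>1 \<beta>0 n = (X, U, V)"
      by (metis prod.exhaust)
    note od = orbit_degrees[OF nz o]
    let ?S = "hom_eval_poly l S X U V" and ?T = "hom_eval_poly l T X U V"
    have H: "H A n = hom_eval_poly k A X U V" "H B n = hom_eval_poly k B X U V"
      by (simp_all add: H_def o)
    have eq: "?S * H A n + ?T * H B n = pcompose \<rho> X * V ^ (k + l)"
    proof (rule poly_eqI_off[of V])
      fix t assume t: "poly V t \<noteq> 0"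
      define z where "z = (poly X t, poly U t / poly V t)"
      have h: "hom_eval i G (poly X t) (poly U t) (poly V t) = poly V t ^ i * eval2 G z"
        if "degree G \<le> i" for G i
        unfolding z_def by (rule hom_eval_eq_eval2[OF that t])
      have "eval2 S z * eval2 A z + eval2 T z * eval2 B z = poly \<rho> (poly X t)"
        using arg_cong[OF \<rho>(2), of "\<lambda>P. eval2 P z"] by (simp add: z_def)
      moreover have l: "degree S \<le> l" "degree T \<le> l"
        by (auto simp: l_def)
      moreover have "poly (?S * H A n + ?T * H B n) t =
          poly V t ^ (k + l) * (eval2 S z * eval2 A z + eval2 T z * eval2 B z)"
        using l deg by (simp add: H poly_hom_eval_poly h power_add algebra_simps)
      ultimately show "poly (?S * H A n + ?T * H B n) t = poly (pcompose \<rho> X * V ^ (k + l)) t"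
        by (simp add: poly_pcompose poly_power)
    qed (use od in auto)
    have "pcompose \<rho> X \<noteq> 0"
      using od \<rho>(1) by (simp add: pcompose_eq_0_iff)
    hence "degree (pcompose \<rho> X * V ^ (k + l)) = degree (pcompose \<rho> X) + (k + l) * n"
      using od by (simp add: degree_mult_eq degree_power_eq)
    hence "(k + l) * n \<le> degree (?S * H A n + ?T * H B n)"
      unfolding eq by simp
    also have "\<dots> \<le> dS + dT + l * n + D"
    proof (rule degree_add_le)
      have "degree ?S \<le> dS + l * n" "degree ?T \<le> dT + l * n"
        using od dS dT by (auto intro!: degree_hom_eval_poly)
      thus "degree (?S * H A n) \<le> dS + dT + l * n + D" "degree (?T * H B n) \<le> dS + dT + l * n + D"
        using HD[of n] degree_mult_le[of ?S "H A n"] degree_mult_le[of ?T "H B n"] by linarith+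
    qed
    finally show ?thesis .
  qed
  have "k * Suc (dS + dT + D) \<le> dS + dT + D"
    using bound[of "Suc (dS + dT + D)"] by (simp add: algebra_simps)
  with \<open>k \<noteq> 0\<close> show False
    by (cases k) auto
qed

section \<open>Uniqueness of the invariant fibration\<close>

lemma invariance_identity:
  assumes V: "eq_off_curve V (\<lambda>z. eval2 A z / eval2 B z)" and "B \<noteq> 0"
    and nc: "\<not> (\<exists>c. eq_off_curve V (\<lambda>_. c))"
    and inv: "eq_off_curve (V \<circ> f) (\<lambda>z. (a * V z + b) / (c * V z + d))"
    and det: "a * d - b * c \<noteq> 0"
    and Vf: "eq_off_curve (V \<circ> f) (\<lambda>z. eval2 N z / eval2 M z)" and "M \<noteq> 0"
  shows "N * (smult [:c:] A + smult [:d:] B) = (smult [:a:] A + smult [:b:] B) * M"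
proof -
  let ?P = "smult [:a:] A + smult [:b:] B" and ?Q = "smult [:c:] A + smult [:d:] B"
  have "\<not> (\<exists>c. eq_off_curve (\<lambda>z. eval2 A z / eval2 B z) (\<lambda>_. c))"
    using V nc eq_off_curve_trans by blast
  hence Q: "?Q \<noteq> 0"
    using \<open>B \<noteq> 0\<close> det by (intro pencil_nonzero) auto
  from V obtain R where R: "R \<noteq> 0" "\<And>z. eval2 R z \<noteq> 0 \<Longrightarrow> V z = eval2 A z / eval2 B z"
    unfolding eq_off_curve_iff by blast
  have "eq_off_curve (\<lambda>z. (a * V z + b) / (c * V z + d)) (\<lambda>z. eval2 ?P z / eval2 ?Q z)"
  proof (rule eq_off_curveI[of "R * B"])
    fix z assume "eval2 (R * B) z \<noteq> 0"
    hence z: "V z = eval2 A z / eval2 B z" "eval2 B z \<noteq> 0"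
      using R(2) by auto
    have cancel: "(p / q) / (r / q) = p / r" if "q \<noteq> 0" for p q r :: complex
      using that by simp
    have eqs: "a * V z + b = eval2 ?P z / eval2 B z" "c * V z + d = eval2 ?Q z / eval2 B z"
      using z(2) by (simp_all add: z(1) add_divide_distrib)
    show "(a * V z + b) / (c * V z + d) = eval2 ?P z / eval2 ?Q z"
      unfolding eqs by (rule cancel[OF z(2)])
  qed (use R \<open>B \<noteq> 0\<close> in auto)
  hence "eq_off_curve (\<lambda>z. eval2 N z / eval2 M z) (\<lambda>z. eval2 ?P z / eval2 ?Q z)"
    using Vf inv eq_off_curve_sym eq_off_curve_trans by blast
  thus ?thesis
    using quotient_eq_iff[OF \<open>M \<noteq> 0\<close> Q] by blast
qed

text \<open>
  For \<open>\<beta>\<^sub>0 = 0\<close> the normal form maps everything to the line \<open>y = 0\<close>, where \<open>V\<close> is a function of \<open>x\<close>. If the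
  denominator of \<open>V\<close> vanishes on that line, the composition is \<open>0\<close> by the convention for division.
\<close>

lemma degenerate_pullback:
  assumes "rational_fun V"
  obtains n m where "m \<noteq> 0"
    "V \<circ> normal_form \<alpha>0 \<alpha>1 0 = (\<lambda>z. eval2 [:n:] z / eval2 [:m:] z)"
proof -
  from assms obtain P Q where V: "\<And>z. V z = eval2 P z / eval2 Q z"
    unfolding rational_fun_def by blast
  let ?r = "\<lambda>G. pcompose (coeff G 0) [:\<alpha>0, \<alpha>1:]"
  have "eval2 G (normal_form \<alpha>0 \<alpha>1 0 z) = poly (?r G) (fst z)" for G z
    by (cases G) (simp add: normal_form_def case_prod_beta poly_pcompose mult.commute)
  hence eq: "V (normal_form \<alpha>0 \<alpha>1 0 z) = poly (?r P) (fst z) / poly (?r Q) (fst z)" for z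
    by (simp add: V)
  show thesis
  proof (cases "?r Q = 0")
    case True
    show thesis
      by (rule that[of 1 0]) (use eq True in auto)
  next
    case False
    show thesis
      by (rule that[of "?r Q" "?r P"]) (use eq False in auto)
  qed
qed

lemma nondegenerate_pullback:
  assumes nz: "\<alpha>1 \<noteq> 0" "\<beta>0 \<noteq> 0"
    and V: "eq_off_curve V (\<lambda>z. eval2 A z / eval2 B z)"
    and deg: "degree A \<le> k" "degree B \<le> k"
  shows "eq_off_curve (V \<circ> normal_form \<alpha>0 \<alpha>1 \<beta>0)
           (\<lambda>z. eval2 (pullback \<alpha>0 \<alpha>1 \<beta>0 k A) z / eval2 (pullback \<alpha>0 \<alpha>1 \<beta>0 k B) z)"
proof -
  from V obtain R where R: "R \<noteq> 0" "\<And>z. eval2 R z \<noteq> 0 \<Longrightarrow> V z = eval2 A z / eval2 B z"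
    unfolding eq_off_curve_iff by blast
  let ?R = "pullback \<alpha>0 \<alpha>1 \<beta>0 (degree R) R"
  show ?thesis
  proof (rule eq_off_curveI[of "?R * [:[:0, 1:], 1:]"])
    show "?R * [:[:0, 1:], 1:] \<noteq> 0"
      using R(1) pullback_eq_0_iff[OF nz order.refl, where G = R]
      by (simp del: mult_pCons_right)
    fix z assume *: "eval2 (?R * [:[:0, 1:], 1:]) z \<noteq> 0"
    obtain x y where z: "z = (x, y)"
      by (cases z)
    have xy: "x + y \<noteq> 0" and "eval2 ?R (x, y) \<noteq> 0"
      using * by (auto simp: z simp del: mult_pCons_right)
    hence "eval2 R (normal_form \<alpha>0 \<alpha>1 \<beta>0 z) \<noteq> 0"
      by (auto simp: z eval2_pullback_normal_form[OF order.refl xy])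
    from R(2)[OF this] show "(V \<circ> normal_form \<alpha>0 \<alpha>1 \<beta>0) z =
        eval2 (pullback \<alpha>0 \<alpha>1 \<beta>0 k A) z / eval2 (pullback \<alpha>0 \<alpha>1 \<beta>0 k B) z"
      using xy by (simp add: z eval2_pullback_normal_form[OF deg(1) xy]
          eval2_pullback_normal_form[OF deg(2) xy])
  qed
qed

text \<open>
  A root of \<open>e\<close> gives a vertical line on which both pullbacks vanish. Then \<open>A\<close> and \<open>B\<close> both vanish on the
  image line and have a common factor.
\<close>

lemma pullback_no_vertical_factor:
  assumes nz: "\<alpha>1 \<noteq> 0" "\<beta>0 \<noteq> 0" and cop: "coprime A B"
    and deg: "degree A \<le> k" "degree B \<le> k"
    and dvd: "[:e:] dvd pullback \<alpha>0 \<alpha>1 \<beta>0 k A" "[:e:] dvd pullback \<alpha>0 \<alpha>1 \<beta>0 k B"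
    and "e \<noteq> 0"
  shows "degree e = 0"
proof (rule ccontr)
  assume "degree e \<noteq> 0"
  hence "\<not> constant (poly e)"
    by (simp add: constant_degree)
  then obtain x where x: "poly e x = 0"
    using fundamental_theorem_of_algebra by blast
  have root: "[:[:- (\<alpha>0 + \<alpha>1 * x), 1:]:] dvd G"
    if "degree G \<le> k" and "[:e:] dvd pullback \<alpha>0 \<alpha>1 \<beta>0 k G" for G
  proof -
    have "eval2 (pullback \<alpha>0 \<alpha>1 \<beta>0 k G) (x, y) = 0" for y
      using that(2) x by (elim dvdE) simp
    hence "poly (coeff G j) (\<alpha>0 + \<alpha>1 * x) = 0" if "j \<le> k" for j
      using nz(2) that pullback_vanishing_line by blast
    hence "poly (coeff G j) (\<alpha>0 + \<alpha>1 * x) = 0" for j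
      using \<open>degree G \<le> k\<close> by (cases "j \<le> k") (auto simp: coeff_eq_0)
    thus ?thesis
      by (simp add: const_poly_dvd_iff poly_eq_0_iff_dvd)
  qed
  have "[:[:- (\<alpha>0 + \<alpha>1 * x), 1:]:] dvd 1"
    using cop root[OF deg(1) dvd(1)] root[OF deg(2) dvd(2)] by (meson coprime_common_divisor)
  thus False
    by (simp add: is_unit_const_poly_iff is_unit_iff_degree)
qed

text \<open>
  For \<open>\<beta>\<^sub>0 \<noteq> 0\<close> invariance reads \<open>A' Q = P B'\<close>, where \<open>A', B'\<close> are the pullbacks of \<open>A, B\<close> and \<open>P, Q\<close> are the members of the
  pencil given by the Moebius map. As \<open>P\<close> and \<open>Q\<close> are coprime, \<open>A' = P E\<close> and \<open>B' = Q E\<close>. Comparing degrees in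
  \<open>y\<close> puts \<open>E\<close> in \<open>\<complex>[x]\<close>, the preceding lemma makes it constant, and the pencil is invariant.
\<close>

lemma preserved_fibration_vertical:
  assumes nz: "\<alpha>1 \<noteq> 0" and pres: "preserves_fibration (normal_form \<alpha>0 \<alpha>1 \<beta>0) V"
  shows "same_fibration V (\<lambda>(x, y). x)"
proof -
  let ?f = "normal_form \<alpha>0 \<alpha>1 \<beta>0"
  from pres obtain a b c d where nc: "nonconst_rational_fun V" and det: "a * d - b * c \<noteq> 0"
    and inv: "eq_off_curve (V \<circ> ?f) (\<lambda>z. (a * V z + b) / (c * V z + d))"
    unfolding preserves_fibration_def by blast
  hence rat: "rational_fun V" and nc': "\<not> (\<exists>c. eq_off_curve V (\<lambda>_. c))"
    by (auto simp: nonconst_rational_fun_def)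
  obtain A B where B: "B \<noteq> 0" and cop: "coprime A B"
    and V: "eq_off_curve V (\<lambda>z. eval2 A z / eval2 B z)"
    using rational_fun_lowest_terms[OF rat] by blast
  have nc'': "\<not> (\<exists>c. eq_off_curve (\<lambda>z. eval2 A z / eval2 B z) (\<lambda>_. c))"
    using V nc' eq_off_curve_trans by blast
  define P where "P = smult [:a:] A + smult [:b:] B"
  define Q where "Q = smult [:c:] A + smult [:d:] B"
  have "P \<noteq> 0" "Q \<noteq> 0"
    unfolding P_def Q_def using det by (auto intro!: pencil_nonzero[OF B nc''])
  have PQ: "coprime P Q"
    unfolding P_def Q_def by (rule coprime_pencil[OF cop det])
  have degPQ: "max (degree P) (degree Q) = max (degree A) (degree B)"
    unfolding P_def Q_def by (rule degree_pencil[OF det])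
  note identity = invariance_identity[OF V B nc' inv det, folded P_def Q_def]
  have "max (degree A) (degree B) = 0"
  proof (cases "\<beta>0 = 0")
    case True
    obtain n m where m: "m \<noteq> 0" and "V \<circ> ?f = (\<lambda>z. eval2 [:n:] z / eval2 [:m:] z)"
      using degenerate_pullback[OF rat] True by metis
    hence eq: "[:n:] * Q = P * [:m:]"
      by (intro identity) (auto simp: eq_off_curve_refl)
    hence "n \<noteq> 0"
      using \<open>P \<noteq> 0\<close> m by auto
    have "P dvd [:n:] * Q" "Q dvd P * [:m:]"
      using eq by (metis dvd_triv_left dvd_triv_right)+
    hence "P dvd [:n:]" "Q dvd [:m:]"
      using PQ by (metis coprime_commute coprime_dvd_mult_left_iff coprime_dvd_mult_right_iff)+
    hence "degree P = 0" "degree Q = 0"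
      using m \<open>n \<noteq> 0\<close> dvd_imp_degree_le[of P "[:n:]"] dvd_imp_degree_le[of Q "[:m:]"] by simp_all
    thus ?thesis
      using degPQ by simp
  next
    case False
    define k where "k = max (degree A) (degree B)"
    have deg: "degree A \<le> k" "degree B \<le> k"
      by (auto simp: k_def)
    let ?A = "pullback \<alpha>0 \<alpha>1 \<beta>0 k A" and ?B = "pullback \<alpha>0 \<alpha>1 \<beta>0 k B"
    have "?B \<noteq> 0"
      using B pullback_eq_0_iff[OF nz False deg(2)] by simp
    have eq: "?A * Q = P * ?B"
      by (rule identity[OF nondegenerate_pullback[OF nz False V deg] \<open>?B \<noteq> 0\<close>])
    hence "Q dvd P * ?B"
      by (metis dvd_triv_right)
    hence "Q dvd ?B"
      using PQ by (metis coprime_commute coprime_dvd_mult_right_iff)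
    then obtain E where E: "?B = Q * E"
      by (elim dvdE)
    have "Q * ?A = Q * (P * E)"
      using eq unfolding E by (simp add: mult_ac)
    hence E': "?A = P * E"
      using \<open>Q \<noteq> 0\<close> mult_left_cancel by blast
    have "E \<noteq> 0"
      using \<open>?B \<noteq> 0\<close> E by auto
    have "degree P + degree E \<le> k" "degree Q + degree E \<le> k"
      using degree_pullback[of \<alpha>0 \<alpha>1 \<beta>0 k A] degree_pullback[of \<alpha>0 \<alpha>1 \<beta>0 k B]
        \<open>P \<noteq> 0\<close> \<open>Q \<noteq> 0\<close> \<open>E \<noteq> 0\<close> unfolding E E' by (simp_all add: degree_mult_eq)
    hence "degree E = 0"
      using degPQ unfolding k_def by linarith
    then obtain e where e: "E = [:e:]"
      by (metis degree_0_id degree_eq_zeroE)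
    have "[:e:] dvd ?A" "[:e:] dvd ?B" "e \<noteq> 0"
      using \<open>E \<noteq> 0\<close> unfolding E E' e by (auto simp del: mult_pCons_right)
    hence "degree e = 0"
      by (rule pullback_no_vertical_factor[OF nz False cop deg])
    then obtain \<epsilon> where \<epsilon>: "E = [:[:\<epsilon>:]:]"
      using e by (metis degree_eq_zeroE)
    have "?A = smult [:\<epsilon> * a:] A + smult [:\<epsilon> * b:] B"
      "?B = smult [:\<epsilon> * c:] A + smult [:\<epsilon> * d:] B"
      unfolding E E' \<epsilon> P_def Q_def by (simp_all add: smult_add_right mult.commute)
    with nz cop deg have "k = 0"
      by (rule invariant_pencil_degree_0)
    thus ?thesis
      by (simp add: k_def)
  qed
  then obtain p q where pq: "A = [:p:]" "B = [:q:]"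
    by (metis degree_eq_zeroE max_nat.eq_neutr_iff)
  show ?thesis
  proof (rule same_fibration_vertical)
    show "eq_off_curve V (\<lambda>z. eval2 [:p:] z / eval2 [:q:] z)"
      using V pq by simp
    show "q \<noteq> 0"
      using B pq by simp
    show "coprime p q"
    proof (rule coprimeI)
      fix r assume "r dvd p" "r dvd q"
      hence "[:r:] dvd A" "[:r:] dvd B"
        by (auto simp: pq)
      with cop have "[:r:] dvd 1"
        by (meson coprime_common_divisor)
      thus "r dvd 1"
        by (simp add: is_unit_const_poly_iff)
    qed
  qed (rule nc)
qed

section \<open>First integrals of the normal form\<close>

lemma normal_form_preserves_vertical:
  assumes "\<alpha>1 \<noteq> 0"
  shows "preserves_fibration (normal_form \<alpha>0 \<alpha>1 \<beta>0) (\<lambda>(x, y). x)"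
  unfolding preserves_fibration_def
proof (intro conjI exI)
  show "nonconst_rational_fun (\<lambda>(x, y). x)"
    using nonconst_vertical[of "[:0, 1:]"] by simp
  show "\<alpha>1 * 1 - \<alpha>0 * 0 \<noteq> 0"
    using assms by simp
  have "(\<lambda>(x, y). x) \<circ> normal_form \<alpha>0 \<alpha>1 \<beta>0 =
      (\<lambda>z. (\<alpha>1 * (case z of (x, y) \<Rightarrow> x) + \<alpha>0) / (0 * (case z of (x, y) \<Rightarrow> x) + 1))"
    by (auto simp: normal_form_def)
  thus "eq_off_curve ((\<lambda>(x, y). x) \<circ> normal_form \<alpha>0 \<alpha>1 \<beta>0)
      (\<lambda>z. (\<alpha>1 * (case z of (x, y) \<Rightarrow> x) + \<alpha>0) / (0 * (case z of (x, y) \<Rightarrow> x) + 1))"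
    using eq_off_curve_refl by metis
qed

lemma affine_funpow:
  fixes \<alpha>0 \<alpha>1 :: complex
  shows "((\<lambda>u. \<alpha>0 + \<alpha>1 * u) ^^ j) x = \<alpha>0 * (\<Sum>i<j. \<alpha>1 ^ i) + \<alpha>1 ^ j * x"
proof (induction j)
  case (Suc j)
  thus ?case
    unfolding sum.lessThan_Suc_shift by (simp add: algebra_simps sum_distrib_left)
qed simp

text \<open>
  The \<open>p\<close>-th iterate of \<open>u \<mapsto> \<alpha>\<^sub>0 + \<alpha>\<^sub>1 u\<close> is the identity, so the map permutes the factors cyclically. Each
  factor is a linear polynomial in \<open>x\<close>, so the product is not constant.
\<close>

lemma orbit_product_first_integral:
  assumes "p > 1" and "\<alpha>1 ^ p = 1" and "\<alpha>1 \<noteq> 1"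
  shows "first_integral (normal_form \<alpha>0 \<alpha>1 \<beta>0)
           (\<lambda>(x, y). \<Prod>j<p. ((\<lambda>u. \<alpha>0 + \<alpha>1 * u) ^^ j) x)"
  unfolding first_integral_def
proof
  let ?m = "\<lambda>u. \<alpha>0 + \<alpha>1 * u"
  define q where "q = (\<Prod>j<p. [:\<alpha>0 * (\<Sum>i<j. \<alpha>1 ^ i), \<alpha>1 ^ j:])"
  have "\<alpha>1 \<noteq> 0"
    using assms(1,2) by (metis not_one_less_zero power_0_left zero_neq_one)
  hence "degree q = (\<Sum>j<p. 1)"
    unfolding q_def by (subst degree_prod_eq_sum_degree) auto
  hence "degree q > 0"
    using assms(1) by simp
  moreover have "poly q x = (\<Prod>j<p. (?m ^^ j) x)" for x
    unfolding affine_funpow by (simp add: q_def poly_prod mult.commute)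
  ultimately show "nonconst_rational_fun (\<lambda>(x, y). \<Prod>j<p. (?m ^^ j) x)"
    using nonconst_vertical[of q] by simp
  have period: "(?m ^^ p) x = x" for x
    using assms(2,3) geometric_sum[of \<alpha>1 p] by (simp add: affine_funpow)
  have "(\<Prod>j<p. (?m ^^ j) (?m x)) = (\<Prod>j<p. (?m ^^ j) x)" for x
  proof -
    obtain q where q: "p = Suc q"
      using assms(1) by (cases p) auto
    have "(\<Prod>j<p. (?m ^^ j) (?m x)) = (\<Prod>j<p. (?m ^^ Suc j) x)"
      by (simp only: funpow_Suc_right o_apply)
    also have "\<dots> = (\<Prod>j<q. (?m ^^ Suc j) x) * x"
      using period[of x] unfolding q by (simp only: prod.lessThan_Suc)
    also have "\<dots> = (\<Prod>j<p. (?m ^^ j) x)"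
      unfolding q prod.lessThan_Suc_shift by (simp only: funpow_0 mult.commute)
    finally show ?thesis .
  qed
  hence "(\<lambda>(x, y). \<Prod>j<p. (?m ^^ j) x) \<circ> normal_form \<alpha>0 \<alpha>1 \<beta>0 = (\<lambda>(x, y). \<Prod>j<p. (?m ^^ j) x)"
    by (auto simp: normal_form_def)
  thus "eq_off_curve ((\<lambda>(x, y). \<Prod>j<p. (?m ^^ j) x) \<circ> normal_form \<alpha>0 \<alpha>1 \<beta>0)
      (\<lambda>(x, y). \<Prod>j<p. (?m ^^ j) x)"
    using eq_off_curve_refl by metis
qed

lemma integrable_vertical_translation_free: "integrable_map (normal_form 0 1 \<beta>0)"
  unfolding integrable_map_def first_integral_def
proof (intro exI conjI)
  show "nonconst_rational_fun (\<lambda>(x, y). x)"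
    using nonconst_vertical[of "[:0, 1:]"] by simp
  have "(\<lambda>(x, y). x) \<circ> normal_form 0 1 \<beta>0 = (\<lambda>(x, y). x)"
    by (auto simp: normal_form_def)
  thus "eq_off_curve ((\<lambda>(x, y). x) \<circ> normal_form 0 1 \<beta>0) (\<lambda>(x, y). x)"
    using eq_off_curve_refl by metis
qed

section \<open>Homogeneous polynomials and degrees of homogeneous maps\<close>

definition homogeneous3 :: "nat \<Rightarrow> poly3 \<Rightarrow> bool" where
  "homogeneous3 d p \<longleftrightarrow> (\<forall>i j k. coeff (coeff (coeff p k) j) i \<noteq> 0 \<longrightarrow> i + j + k = d)"

lemma homogeneous3_add: "homogeneous3 d p \<Longrightarrow> homogeneous3 d q \<Longrightarrow> homogeneous3 d (p + q)"
  unfolding homogeneous3_def by (metis add.right_neutral coeff_add)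

lemma homogeneous3_mult:
  assumes "homogeneous3 d p" and "homogeneous3 e q"
  shows "homogeneous3 (d + e) (p * q)"
  unfolding homogeneous3_def
proof (intro allI impI)
  fix i j k assume "coeff (coeff (coeff (p * q) k) j) i \<noteq> 0"
  then obtain k' j' i' where "k' \<le> k" "j' \<le> j" "i' \<le> i"
    and "coeff (coeff (coeff p k') j') i' * coeff (coeff (coeff q (k - k')) (j - j')) (i - i') \<noteq> 0"
    by (auto simp: coeff_mult coeff_sum elim!: sum.not_neutral_contains_not_neutral)
  moreover from this have "i' + j' + k' = d" "(i - i') + (j - j') + (k - k') = e"
    using assms unfolding homogeneous3_def by (metis mult_zero_left mult_zero_right)+
  ultimately show "i + j + k = d + e"
    by linarith
qed

lemma homogeneous3_const: "homogeneous3 0 (const3 c)"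
  by (auto simp: homogeneous3_def const3_def coeff_pCons split: nat.splits)

lemma homogeneous3_X: "homogeneous3 1 X0" "homogeneous3 1 X1" "homogeneous3 1 X2"
  by (auto simp: homogeneous3_def X0_def X1_def X2_def coeff_pCons split: nat.splits)

lemma homogeneous3_const_mult: "homogeneous3 d p \<Longrightarrow> homogeneous3 d (const3 c * p)"
  using homogeneous3_mult[OF homogeneous3_const] by simp

lemma homogeneous3_unit:
  assumes "is_unit u"
  shows "homogeneous3 0 u"
proof -
  from assms obtain c where "u = const3 c"
    unfolding is_unit_poly_iff const3_def by auto
  thus ?thesis
    by (simp add: homogeneous3_const)
qed

lemma total_degree3_homogeneous:
  assumes "homogeneous3 d p"
  shows "total_degree3 p = (if p = 0 then 0 else d)"
proof (cases "p = 0")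
  case True
  thus ?thesis
    by (simp add: total_degree3_def)
next
  case False
  then obtain k where "coeff p k \<noteq> 0"
    by (metis leading_coeff_0_iff)
  then obtain j where "coeff (coeff p k) j \<noteq> 0"
    by (metis leading_coeff_0_iff)
  then obtain i where i: "coeff (coeff (coeff p k) j) i \<noteq> 0"
    by (metis leading_coeff_0_iff)
  hence "{i + j + k | i j k. coeff (coeff (coeff p k) j) i \<noteq> 0} = {d}"
    using assms unfolding homogeneous3_def by blast
  thus ?thesis
    using False by (simp add: total_degree3_def)
qed

lemma const3_ring [simp]:
  "const3 0 = 0" "const3 1 = 1"
  "const3 (a + b) = const3 a + const3 b" "const3 (a * b) = const3 a * const3 b"
  "const3 (a - b) = const3 a - const3 b" "const3 (- a) = - const3 a"
  by (simp_all add: const3_def one_pCons)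

lemma const3_eq_0_iff [simp]: "const3 a = 0 \<longleftrightarrow> a = 0"
  by (simp add: const3_def)

lemma is_unit_const3: "a \<noteq> 0 \<Longrightarrow> is_unit (const3 a)"
  by (simp add: const3_def is_unit_const_poly_iff dvd_field_iff)

lemma prime_elem_dvd_const3_mult:
  assumes "a \<noteq> 0" and "\<pi> dvd const3 a * p"
  shows "\<pi> dvd p"
  using assms by (simp add: is_unit_const3 dvd_mult_unit_iff')

lemma prime_elem_X0: "prime_elem X0"
proof -
  have "prime_elem [:0, 1 :: complex:]"
    by (intro irreducible_imp_prime_elem irreducible_linear_poly) auto
  thus ?thesis
    by (simp add: X0_def prime_elem_const_poly_iff)
qed

lemma X0_dvd_iff: "X0 dvd p \<longleftrightarrow> (\<forall>k j. coeff (coeff (coeff p k) j) 0 = 0)"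
proof -
  have "[:0, 1:] dvd r \<longleftrightarrow> coeff r 0 = 0" for r :: "complex poly"
    using poly_eq_0_iff_dvd[of r 0] by (simp add: poly_0_coeff_0)
  thus ?thesis
    by (simp add: X0_def const_poly_dvd_iff)
qed

lemma prime_elem_dvd_X0:
  assumes "prime_elem \<pi>" and "\<pi> dvd X0" and "\<pi> dvd p"
  shows "X0 dvd p"
proof -
  have "X0 dvd \<pi>"
    using assms(1,2) prime_elem_X0
    by (metis irreducible_altdef prime_elem_imp_irreducible prime_elem_not_unit)
  thus ?thesis
    using assms(3) dvd_trans by blast
qed

text \<open>
  Dividing out the greatest common divisor of \<open>(D F\<^sub>0, D F\<^sub>1, D F\<^sub>2)\<close> leaves the coprime triple up to a unit,
  and units are constants.
\<close>

lemma hom_degree_eq: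
  fixes F0 F1 F2 :: poly3
  assumes hom: "homogeneous3 d F0" "homogeneous3 d F1" "homogeneous3 d F2"
    and D: "D \<noteq> 0"
    and cop: "\<And>\<pi>. prime_elem \<pi> \<Longrightarrow> \<not> (\<pi> dvd F0 \<and> \<pi> dvd F1 \<and> \<pi> dvd F2)"
  shows "hom_degree (D * F0, D * F1, D * F2) = d"
proof -
  have nz: "F0 \<noteq> 0 \<or> F1 \<noteq> 0 \<or> F2 \<noteq> 0"
    using cop[OF prime_elem_X0] by auto
  define g where "g = gcd F0 (gcd F1 F2)"
  have "g \<noteq> 0"
    using nz by (auto simp: g_def)
  have "is_unit g"
  proof (rule ccontr)
    assume "\<not> is_unit g"
    then obtain \<pi> where "prime \<pi>" "\<pi> dvd g"
      using \<open>g \<noteq> 0\<close> prime_divisorE by blast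
    thus False
      using cop[of \<pi>] by (auto simp: g_def)
  qed
  hence g: "g = 1"
    unfolding g_def by (metis is_unit_normalize normalize_gcd)
  have "gcd (D * F0) (gcd (D * F1) (D * F2)) = normalize D * g"
    unfolding g_def
    by (metis gcd_mult_left normalize_gcd_right normalize_gcd normalize_mult)
  hence gcd: "gcd (D * F0) (gcd (D * F1) (D * F2)) = normalize D"
    using g by simp
  define u where "u = unit_factor D"
  have u: "is_unit u"
    using D by (simp add: u_def)
  have div: "(D * F) div normalize D = u * F" for F
  proof -
    have "D * F = normalize D * (u * F)"
      unfolding u_def by (metis mult.assoc normalize_mult_unit_factor)
    thus ?thesis
      using D by (metis nonzero_mult_div_cancel_left normalize_eq_0_iff)
  qed
  have "u \<noteq> 0"
    using u by auto
  hence "total_degree3 (u * F) = (if F = 0 then 0 else d)" if "homogeneous3 d F" for F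
    using total_degree3_homogeneous[OF homogeneous3_mult[OF homogeneous3_unit[OF u] that]] by simp
  thus ?thesis
    unfolding hom_degree_def remove_common_factors_def
    using hom nz by (auto simp: gcd div Let_def)
qed

text \<open>
  The linear form \<open>hom_form a\<close> evaluated at a triple.
\<close>

definition lin3 :: "(nat \<Rightarrow> complex) \<Rightarrow> poly3 \<Rightarrow> poly3 \<Rightarrow> poly3 \<Rightarrow> poly3" where
  "lin3 a P Q R = const3 (a 0) * P + const3 (a 1) * Q + const3 (a 2) * R"

lemma hom_form_explicit: "hom_form a = [:[:[:0, a 0:], [:a 1:]:], [:[:a 2:]:]:]"
  by (simp add: hom_form_def const3_def X0_def X1_def X2_def)

lemma hom_comp_family_ext:
  "hom_comp (family_ext \<alpha> \<beta> \<gamma>) (P, Q, R) =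
     (P * lin3 \<gamma> P Q R, lin3 \<alpha> P Q R * lin3 \<gamma> P Q R, P * lin3 \<beta> P Q R)"
  by (simp add: hom_comp_def family_ext_def subst3_def lin3_def hom_form_explicit X0_def
      map_poly_pCons) (simp add: algebra_simps)

section \<open>Degrees of the iterates\<close>

lemma lin3_proportional:
  assumes "\<beta> 1 = l * \<gamma> 1" "\<beta> 2 = l * \<gamma> 2" "\<beta> 0 = l * \<gamma> 0 + b"
  shows "lin3 \<beta> P Q R = const3 l * lin3 \<gamma> P Q R + const3 b * P"
  unfolding lin3_def assms by (simp add: algebra_simps)

lemma hom_iter_Suc: "hom_iter F (Suc n) = hom_comp F (hom_iter F n)"
  by (simp add: hom_iter_def)

lemma homogeneous3_lin3:
  assumes "homogeneous3 d P" "homogeneous3 d Q" "homogeneous3 d R"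
  shows "homogeneous3 d (lin3 a P Q R)"
  unfolding lin3_def by (intro homogeneous3_add homogeneous3_const_mult assms)

text \<open>
  Let \<open>(P, Q, R)\<close> be an iterate and \<open>\<pi>\<close> a prime factor of \<open>P\<close>. The inductive invariant is that modulo \<open>\<pi>\<close>
  neither \<open>\<alpha>\<^sub>1 Q + \<alpha>\<^sub>2 R\<close> nor \<open>\<gamma>\<^sub>1 Q + \<gamma>\<^sub>2 R\<close> vanishes: geometrically, the curve \<open>\<pi> = 0\<close>, which is mapped to the
  line at infinity, is not mapped to an indeterminacy point. In particular \<open>\<pi>\<close> is not a common factor.
\<close>

lemma hom_degree_doubling:
  assumes \<beta>: "\<beta> 1 = l * \<gamma> 1" "\<beta> 2 = l * \<gamma> 2" "\<beta> 0 = l * \<gamma> 0 + b"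
    and nz: "b \<noteq> 0" "\<gamma> 1 \<noteq> 0" "\<gamma> 2 \<noteq> 0" "\<alpha> 1 \<noteq> 0" "\<alpha> 2 \<noteq> 0"
  shows "hom_degree (hom_iter (family_ext \<alpha> \<beta> \<gamma>) n) = 2 ^ n"
proof -
  let ?F = "family_ext \<alpha> \<beta> \<gamma>"
  have "\<exists>P Q R. hom_iter ?F n = (P, Q, R) \<and>
      homogeneous3 (2 ^ n) P \<and> homogeneous3 (2 ^ n) Q \<and> homogeneous3 (2 ^ n) R \<and>
      (\<forall>\<pi>. prime_elem \<pi> \<and> \<pi> dvd P \<longrightarrow>
        \<not> \<pi> dvd const3 (\<alpha> 1) * Q + const3 (\<alpha> 2) * R \<and>
        \<not> \<pi> dvd const3 (\<gamma> 1) * Q + const3 (\<gamma> 2) * R)"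
  proof (induction n)
    case 0
    have "\<not> X0 dvd const3 c * X1 + const3 d * X2" if "c \<noteq> 0" for c d
      unfolding X0_dvd_iff not_all
      by (rule exI[of _ 0], rule exI[of _ 1]) (use that in \<open>simp add: const3_def X1_def X2_def\<close>)
    hence "\<forall>\<pi>. prime_elem \<pi> \<and> \<pi> dvd X0 \<longrightarrow>
        \<not> \<pi> dvd const3 (\<alpha> 1) * X1 + const3 (\<alpha> 2) * X2 \<and>
        \<not> \<pi> dvd const3 (\<gamma> 1) * X1 + const3 (\<gamma> 2) * X2"
      using nz prime_elem_dvd_X0 by blast
    thus ?case
      using homogeneous3_X by (simp add: hom_iter_def)
  next
    case (Suc n)
    then obtain P Q R where it: "hom_iter ?F n = (P, Q, R)"
      and hom: "homogeneous3 (2 ^ n) P" "homogeneous3 (2 ^ n) Q" "homogeneous3 (2 ^ n) R"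
      and IH: "\<And>\<pi>. prime_elem \<pi> \<Longrightarrow> \<pi> dvd P \<Longrightarrow>
        \<not> \<pi> dvd const3 (\<alpha> 1) * Q + const3 (\<alpha> 2) * R"
        "\<And>\<pi>. prime_elem \<pi> \<Longrightarrow> \<pi> dvd P \<Longrightarrow>
        \<not> \<pi> dvd const3 (\<gamma> 1) * Q + const3 (\<gamma> 2) * R"
      by blast
    define \<Gamma> A where "\<Gamma> = lin3 \<gamma> P Q R" and "A = lin3 \<alpha> P Q R"
    have iter: "hom_iter ?F (Suc n) = (P * \<Gamma>, A * \<Gamma>, P * (const3 l * \<Gamma> + const3 b * P))"
      using lin3_proportional[where P = P and Q = Q and R = R, of \<beta> l \<gamma> b, OF \<beta>]
      by (simp add: hom_iter_Suc it hom_comp_family_ext \<Gamma>_def A_def)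
    have hom\<Gamma>: "homogeneous3 (2 ^ n) \<Gamma>" "homogeneous3 (2 ^ n) A"
      unfolding \<Gamma>_def A_def by (intro homogeneous3_lin3 hom)+
    have "homogeneous3 (2 ^ n + 2 ^ n) (P * \<Gamma>)" "homogeneous3 (2 ^ n + 2 ^ n) (A * \<Gamma>)"
      "homogeneous3 (2 ^ n + 2 ^ n) (P * (const3 l * \<Gamma> + const3 b * P))"
      by (intro homogeneous3_mult homogeneous3_add homogeneous3_const_mult hom hom\<Gamma>)+
    moreover have "False" if \<pi>: "prime_elem \<pi>" "\<pi> dvd P * \<Gamma>"
      and dvd: "\<pi> dvd const3 s * (A * \<Gamma>) + const3 t * (P * (const3 l * \<Gamma> + const3 b * P))"
      and st: "s \<noteq> 0" "t \<noteq> 0" for \<pi> s t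
    proof (cases "\<pi> dvd P")
      case True
      hence "\<pi> dvd const3 s * (A * \<Gamma>)"
        using dvd by (metis dvd_add_left_iff dvd_mult dvd_mult2)
      hence "\<pi> dvd A \<or> \<pi> dvd \<Gamma>"
        using st \<pi>(1) prime_elem_dvd_const3_mult prime_elem_dvd_mult_iff by blast
      moreover have "\<pi> dvd lin3 a P Q R \<longleftrightarrow> \<pi> dvd const3 (a 1) * Q + const3 (a 2) * R" for a
        unfolding lin3_def add.assoc using True by (simp add: dvd_add_right_iff)
      ultimately show False
        using IH[OF \<pi>(1) True] unfolding \<Gamma>_def A_def by blast
    next
      case False
      hence \<Gamma>: "\<pi> dvd \<Gamma>"
        using \<pi> by (simp add: prime_elem_dvd_mult_iff)
      hence "\<pi> dvd const3 t * (P * (const3 l * \<Gamma> + const3 b * P))"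
        using dvd by (metis dvd_add_right_iff dvd_mult)
      hence "\<pi> dvd const3 l * \<Gamma> + const3 b * P"
        using st(2) \<pi>(1) False prime_elem_dvd_const3_mult prime_elem_dvd_mult_iff by blast
      hence "\<pi> dvd const3 b * P"
        using \<Gamma> by (simp add: dvd_add_right_iff)
      thus False
        using False nz(1) prime_elem_dvd_const3_mult by blast
    qed
    ultimately show ?case
      unfolding iter using nz by (auto simp: mult_2)
  qed
  then obtain P Q R where it: "hom_iter ?F n = (P, Q, R)"
    and hom: "homogeneous3 (2 ^ n) P" "homogeneous3 (2 ^ n) Q" "homogeneous3 (2 ^ n) R"
    and cop: "\<And>\<pi>. prime_elem \<pi> \<Longrightarrow> \<pi> dvd P \<Longrightarrow>
      \<not> \<pi> dvd const3 (\<alpha> 1) * Q + const3 (\<alpha> 2) * R"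
    by blast
  have "\<not> (\<pi> dvd P \<and> \<pi> dvd Q \<and> \<pi> dvd R)" if "prime_elem \<pi>" for \<pi>
    using cop[OF that] by auto
  from hom_degree_eq[OF hom _ this, of 1] show ?thesis
    by (simp add: it)
qed

text \<open>
  For \<open>\<alpha>\<^sub>1 = 0\<close> the entries are the \<open>T\<^sub>n\<close> with \<open>\<gamma>\<^sub>0 + \<gamma>\<^sub>1 x\<^sub>1 + \<gamma>\<^sub>2 x\<^sub>2 = T\<^sub>n / (T\<^sub>n\<^sub>-\<^sub>1 T\<^sub>n\<^sub>-\<^sub>2)\<close> at the \<open>n\<close>-th point of an orbit, shifted
  by three so that \<open>T\<^sub>0 = hom_form \<gamma>\<close> has index \<open>3\<close>. The three entries before it are chosen such that the
  formula for the iterates in \<open>hom_degree_fibonacci\<close> already holds for the first iterate.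
\<close>

fun denom :: "(nat \<Rightarrow> complex) \<Rightarrow> (nat \<Rightarrow> complex) \<Rightarrow> complex \<Rightarrow> complex \<Rightarrow> nat \<Rightarrow> poly3" where
  "denom \<alpha> \<gamma> l b 0 = const3 (1 / b) * (X2 - const3 l * X0)"
| "denom \<alpha> \<gamma> l b (Suc 0) = 1"
| "denom \<alpha> \<gamma> l b (Suc (Suc 0)) = X0"
| "denom \<alpha> \<gamma> l b (Suc (Suc (Suc 0))) = hom_form \<gamma>"
| "denom \<alpha> \<gamma> l b (Suc (Suc (Suc (Suc n)))) =
     const3 (\<gamma> 0 + \<gamma> 1 * (\<alpha> 0 + \<alpha> 2 * l) + \<gamma> 2 * l) *
       (denom \<alpha> \<gamma> l b (Suc (Suc (Suc n))) * denom \<alpha> \<gamma> l b (Suc (Suc n))) +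
     const3 (\<gamma> 1 * (\<alpha> 2 * b)) *
       (denom \<alpha> \<gamma> l b (Suc (Suc (Suc n))) * (denom \<alpha> \<gamma> l b (Suc n) * denom \<alpha> \<gamma> l b n)) +
     const3 (\<gamma> 2 * b) *
       (denom \<alpha> \<gamma> l b (Suc (Suc n)) * (denom \<alpha> \<gamma> l b (Suc (Suc n)) * denom \<alpha> \<gamma> l b (Suc n)))"

definition no_common_prime :: "poly3 \<Rightarrow> poly3 \<Rightarrow> bool" where
  "no_common_prime p q \<longleftrightarrow> (\<forall>\<pi>. prime_elem \<pi> \<longrightarrow> \<not> (\<pi> dvd p \<and> \<pi> dvd q))"

lemma no_common_prime_one [simp]: "no_common_prime 1 p" "no_common_prime p 1"
  by (auto simp: no_common_prime_def dest: prime_elem_not_unit)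

lemma no_common_prime_X0: "\<not> X0 dvd p \<Longrightarrow> no_common_prime X0 p"
  unfolding no_common_prime_def using prime_elem_dvd_X0 by blast

text \<open>
  Modulo the previous entry only the third summand of the recurrence survives, modulo the entry before
  that only the second one. Both have nonzero coefficients and are products of entries already
  known to be coprime to the modulus.
\<close>

lemma denom_coprime:
  assumes nz: "b \<noteq> 0" "\<gamma> 1 \<noteq> 0" "\<gamma> 2 \<noteq> 0" "\<alpha> 2 \<noteq> 0"
  shows "no_common_prime (denom \<alpha> \<gamma> l b n) (denom \<alpha> \<gamma> l b (Suc n))"
    and "no_common_prime (denom \<alpha> \<gamma> l b n) (denom \<alpha> \<gamma> l b (Suc (Suc n)))"
proof -
  let ?t = "denom \<alpha> \<gamma> l b"
  have "no_common_prime (?t n) (?t (Suc n)) \<and>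
      no_common_prime (?t (Suc n)) (?t (Suc (Suc n))) \<and>
      no_common_prime (?t (Suc (Suc n))) (?t (Suc (Suc (Suc n)))) \<and>
      no_common_prime (?t n) (?t (Suc (Suc n))) \<and>
      no_common_prime (?t (Suc n)) (?t (Suc (Suc (Suc n))))"
  proof (induction n)
    case 0
    have "\<not> X0 dvd const3 (1 / b) * (X2 - const3 l * X0)"
      unfolding X0_dvd_iff not_all
      by (rule exI[of _ 1], rule exI[of _ 0]) (use nz in \<open>simp add: const3_def X0_def X2_def\<close>)
    moreover have "\<not> X0 dvd hom_form \<gamma>"
      unfolding X0_dvd_iff not_all
      by (rule exI[of _ 0], rule exI[of _ 1]) (use nz in \<open>simp add: hom_form_explicit\<close>)
    ultimately show ?case
      using no_common_prime_X0 by (auto simp: no_common_prime_def dest: prime_elem_not_unit)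
  next
    case (Suc n)
    define t0 t1 t2 t3 where "t0 = ?t n" and "t1 = ?t (Suc n)" and "t2 = ?t (Suc (Suc n))"
      and "t3 = ?t (Suc (Suc (Suc n)))"
    define c where "c = \<gamma> 0 + \<gamma> 1 * (\<alpha> 0 + \<alpha> 2 * l) + \<gamma> 2 * l"
    have t4: "?t (Suc (Suc (Suc (Suc n)))) = const3 c * (t3 * t2) +
        const3 (\<gamma> 1 * (\<alpha> 2 * b)) * (t3 * (t1 * t0)) + const3 (\<gamma> 2 * b) * (t2 * (t2 * t1))"
      unfolding t0_def t1_def t2_def t3_def c_def by (rule denom.simps)
    note IH = Suc[folded t0_def t1_def t2_def t3_def, unfolded no_common_prime_def]
    have "no_common_prime t3 (?t (Suc (Suc (Suc (Suc n)))))"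
      unfolding no_common_prime_def
    proof safe
      fix \<pi> assume \<pi>: "prime_elem \<pi>" "\<pi> dvd t3" "\<pi> dvd ?t (Suc (Suc (Suc (Suc n))))"
      have "\<pi> dvd const3 c * (t3 * t2) + const3 (\<gamma> 1 * (\<alpha> 2 * b)) * (t3 * (t1 * t0))"
        using \<pi>(2) by (intro dvd_add dvd_mult dvd_mult2)
      hence "\<pi> dvd const3 (\<gamma> 2 * b) * (t2 * (t2 * t1))"
        using \<pi>(3) unfolding t4 by (simp only: dvd_add_right_iff)
      hence "\<pi> dvd t2 * (t2 * t1)"
        by (rule prime_elem_dvd_const3_mult[of "\<gamma> 2 * b", rotated]) (use nz in simp)
      hence "\<pi> dvd t2 \<or> \<pi> dvd t1"
        using \<pi>(1) by (auto simp: prime_elem_dvd_mult_iff)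
      thus False
        using IH \<pi>(1,2) by blast
    qed
    moreover have "no_common_prime t2 (?t (Suc (Suc (Suc (Suc n)))))"
      unfolding no_common_prime_def
    proof safe
      fix \<pi> assume \<pi>: "prime_elem \<pi>" "\<pi> dvd t2" "\<pi> dvd ?t (Suc (Suc (Suc (Suc n))))"
      have "\<pi> dvd const3 c * (t3 * t2)" "\<pi> dvd const3 (\<gamma> 2 * b) * (t2 * (t2 * t1))"
        using \<pi>(2) by (intro dvd_mult dvd_mult2; assumption)+
      hence "\<pi> dvd const3 (\<gamma> 1 * (\<alpha> 2 * b)) * (t3 * (t1 * t0))"
        using \<pi>(3) unfolding t4 by (simp only: dvd_add_left_iff dvd_add_right_iff)
      hence "\<pi> dvd t3 * (t1 * t0)"
        by (rule prime_elem_dvd_const3_mult[of "\<gamma> 1 * (\<alpha> 2 * b)", rotated]) (use nz in simp)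
      hence "\<pi> dvd t3 \<or> \<pi> dvd t1 \<or> \<pi> dvd t0"
        using \<pi>(1) by (auto simp: prime_elem_dvd_mult_iff)
      thus False
        using IH \<pi>(1,2) by blast
    qed
    ultimately show ?case
      using Suc unfolding t2_def t3_def by blast
  qed
  thus "no_common_prime (?t n) (?t (Suc n))" "no_common_prime (?t n) (?t (Suc (Suc n)))"
    by blast+
qed

text \<open>
  The degrees \<open>1, 0, 1, 1, 2, 3, 5, ...\<close> continue the Fibonacci numbers to the left.
\<close>

definition denom_degree :: "nat \<Rightarrow> nat" where
  "denom_degree n = (case n of 0 \<Rightarrow> 1 | Suc m \<Rightarrow> fib m)"

lemma denom_degree_rec: "denom_degree (Suc (Suc n)) = denom_degree (Suc n) + denom_degree n"
  by (cases n) (auto simp: denom_degree_def)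

lemma homogeneous3_hom_form: "homogeneous3 1 (hom_form a)"
  unfolding hom_form_def by (intro homogeneous3_add homogeneous3_const_mult homogeneous3_X)

lemma homogeneous3_uminus: "homogeneous3 d p \<Longrightarrow> homogeneous3 d (- p)"
  by (simp add: homogeneous3_def)

lemma denom_homogeneous: "homogeneous3 (denom_degree n) (denom \<alpha> \<gamma> l b n)"
proof (induction \<alpha> \<gamma> l b n rule: denom.induct)
  case (1 \<alpha> \<gamma> l b)
  have "homogeneous3 1 (const3 (1 / b) * (X2 + - (const3 l * X0)))"
    by (intro homogeneous3_add homogeneous3_const_mult homogeneous3_uminus homogeneous3_X)
  thus ?case
    by (simp add: denom_degree_def)
next
  case (2 \<alpha> \<gamma> l b)
  thus ?case
    using homogeneous3_const[of 1] by (simp add: denom_degree_def)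
next
  case (3 \<alpha> \<gamma> l b)
  thus ?case
    using homogeneous3_X by (simp add: denom_degree_def)
next
  case (4 \<alpha> \<gamma> l b)
  thus ?case
    using homogeneous3_hom_form by (simp add: denom_degree_def numeral_eq_Suc)
next
  case (5 \<alpha> \<gamma> l b n)
  let ?d = denom_degree
  let ?t = "denom \<alpha> \<gamma> l b"
  have d: "?d (Suc (Suc (Suc n))) + (?d (Suc n) + ?d n) = ?d (Suc (Suc (Suc n))) + ?d (Suc (Suc n))"
    "?d (Suc (Suc n)) + (?d (Suc (Suc n)) + ?d (Suc n)) = ?d (Suc (Suc (Suc n))) + ?d (Suc (Suc n))"
    by (simp_all add: denom_degree_rec)
  show ?case
    unfolding denom.simps denom_degree_rec[of "Suc (Suc n)"]
  proof (intro homogeneous3_add homogeneous3_const_mult)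
    show "homogeneous3 (?d (Suc (Suc (Suc n))) + ?d (Suc (Suc n)))
        (?t (Suc (Suc (Suc n))) * ?t (Suc (Suc n)))"
      by (intro homogeneous3_mult 5)
    show "homogeneous3 (?d (Suc (Suc (Suc n))) + ?d (Suc (Suc n)))
        (?t (Suc (Suc (Suc n))) * (?t (Suc n) * ?t n))"
      unfolding d(1)[symmetric] by (intro homogeneous3_mult 5)
    show "homogeneous3 (?d (Suc (Suc (Suc n))) + ?d (Suc (Suc n)))
        (?t (Suc (Suc n)) * (?t (Suc (Suc n)) * ?t (Suc n)))"
      unfolding d(2)[symmetric] by (intro homogeneous3_mult 5)
  qed
qed

text \<open>
  If the next entry were zero, coprimality would make the present one a unit, but its degree is
  positive.
\<close>

lemma denom_nonzero:
  assumes "b \<noteq> 0" "\<gamma> 1 \<noteq> 0" "\<gamma> 2 \<noteq> 0" "\<alpha> 2 \<noteq> 0"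
  shows "denom \<alpha> \<gamma> l b (Suc (Suc n)) \<noteq> 0"
proof (induction n)
  case 0
  show ?case
    using prime_elem_X0 by auto
next
  case (Suc n)
  show ?case
  proof
    assume "denom \<alpha> \<gamma> l b (Suc (Suc (Suc n))) = 0"
    hence "\<not> \<pi> dvd denom \<alpha> \<gamma> l b (Suc (Suc n))" if "prime_elem \<pi>" for \<pi>
      using denom_coprime(1)[of b \<gamma> \<alpha>, OF assms, of l "Suc (Suc n)"] that
      by (auto simp: no_common_prime_def)
    hence unit: "is_unit (denom \<alpha> \<gamma> l b (Suc (Suc n)))"
      using Suc prime_divisorE[of "denom \<alpha> \<gamma> l b (Suc (Suc n))"] prime_imp_prime_elem by blast
    hence "total_degree3 (denom \<alpha> \<gamma> l b (Suc (Suc n))) = 0"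
      using total_degree3_homogeneous[OF homogeneous3_unit[OF unit]] by simp
    hence "denom_degree (Suc (Suc n)) = 0"
      using total_degree3_homogeneous[OF denom_homogeneous[of "Suc (Suc n)" \<alpha> \<gamma> l b]] Suc by simp
    thus False
      using fib_neq_0_nat[of "Suc n"] by (simp add: denom_degree_def)
  qed
qed

text \<open>
  With \<open>t\<^sub>0, ..., t\<^sub>3\<close> consecutive entries of \<open>denom\<close>, the iterate is \<open>(t\<^sub>3 t\<^sub>2, q t\<^sub>3, t\<^sub>2 r)\<close> up to a common factor.
  Applying the map once more makes all components divisible by \<open>t\<^sub>2\<close>: the first and third inherit it from
  \<open>t\<^sub>3 t\<^sub>2\<close>, and the second because \<open>\<alpha>\<^sub>0 x\<^sub>0 + \<alpha>\<^sub>2 x\<^sub>2\<close> does not involve the component \<open>q t\<^sub>3\<close>. No further common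
  factor exists, since entries at distance one and two are coprime.
\<close>

lemma hom_degree_fibonacci:
  assumes \<beta>: "\<beta> 1 = l * \<gamma> 1" "\<beta> 2 = l * \<gamma> 2" "\<beta> 0 = l * \<gamma> 0 + b"
    and nz: "b \<noteq> 0" "\<gamma> 1 \<noteq> 0" "\<gamma> 2 \<noteq> 0" "\<alpha> 2 \<noteq> 0" and "\<alpha> 1 = 0"
  shows "hom_degree (hom_iter (family_ext \<alpha> \<beta> \<gamma>) (Suc n)) = fib (Suc (Suc (Suc n)))"
proof -
  let ?F = "family_ext \<alpha> \<beta> \<gamma>"
  let ?t = "denom \<alpha> \<gamma> l b"
  let ?c = "const3 (\<alpha> 0 + \<alpha> 2 * l)" and ?b = "const3 (\<alpha> 2 * b)"
  let ?P = "\<lambda>n. ?t (Suc (Suc (Suc n))) * ?t (Suc (Suc n))"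
  let ?Q = "\<lambda>n. (?c * ?t (Suc (Suc n)) + ?b * (?t (Suc n) * ?t n)) * ?t (Suc (Suc (Suc n)))"
  let ?R = "\<lambda>n. ?t (Suc (Suc n)) *
    (const3 l * ?t (Suc (Suc (Suc n))) + const3 b * (?t (Suc (Suc n)) * ?t (Suc n)))"
  have "\<exists>D. D \<noteq> 0 \<and> hom_iter ?F (Suc n) = (D * ?P n, D * ?Q n, D * ?R n)"
  proof (induction n)
    case 0
    have "const3 b * const3 (1 / b) = const3 (b * (1 / b))"
      by (simp only: const3_ring)
    hence b: "const3 b * (const3 (1 / b) * p) = p" for p
      using nz(1) by (simp add: mult.assoc[symmetric])
    have "hom_iter ?F (Suc 0) = (X0 * hom_form \<gamma>, hom_form \<alpha> * hom_form \<gamma>,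
        X0 * (const3 l * hom_form \<gamma> + const3 b * X0))"
      using lin3_proportional[where P = X0 and Q = X1 and R = X2, of \<beta> l \<gamma> b, OF \<beta>]
      by (simp add: hom_iter_def hom_comp_family_ext lin3_def hom_form_def)
    moreover have "hom_form \<alpha> = ?c * X0 + ?b * (1 * ?t 0)"
      using \<open>\<alpha> 1 = 0\<close> by (simp add: hom_form_def b mult.assoc) (simp add: algebra_simps)
    ultimately show ?case
      by (intro exI[of _ 1]) (simp add: mult.commute)
  next
    case (Suc n)
    then obtain D where D: "D \<noteq> 0" "hom_iter ?F (Suc n) = (D * ?P n, D * ?Q n, D * ?R n)"
      by blast
    define t0 t1 t2 t3 t4 where t: "t0 = ?t n" "t1 = ?t (Suc n)" "t2 = ?t (Suc (Suc n))"
      "t3 = ?t (Suc (Suc (Suc n)))" "t4 = ?t (Suc (Suc (Suc (Suc n))))"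
    note D = D[folded t]
    have t4: "t4 = const3 (\<gamma> 0 + \<gamma> 1 * (\<alpha> 0 + \<alpha> 2 * l) + \<gamma> 2 * l) * (t3 * t2) +
        const3 (\<gamma> 1 * (\<alpha> 2 * b)) * (t3 * (t1 * t0)) + const3 (\<gamma> 2 * b) * (t2 * (t2 * t1))"
      unfolding t by simp
    have \<Gamma>: "lin3 \<gamma> (D * (t3 * t2)) (D * ((?c * t2 + ?b * (t1 * t0)) * t3))
        (D * (t2 * (const3 l * t3 + const3 b * (t2 * t1)))) = D * t4"
      unfolding t4 lin3_def by (simp add: algebra_simps)
    have A: "lin3 \<alpha> (D * (t3 * t2)) (D * ((?c * t2 + ?b * (t1 * t0)) * t3))
        (D * (t2 * (const3 l * t3 + const3 b * (t2 * t1)))) = D * (t2 * (?c * t3 + ?b * (t2 * t1)))"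
      unfolding lin3_def using \<open>\<alpha> 1 = 0\<close> by (simp add: algebra_simps)
    have "hom_iter ?F (Suc (Suc n)) = (D * (t3 * t2) * (D * t4),
        D * (t2 * (?c * t3 + ?b * (t2 * t1))) * (D * t4),
        D * (t3 * t2) * (const3 l * (D * t4) + const3 b * (D * (t3 * t2))))"
      unfolding hom_iter_Suc[of ?F "Suc n"] D(2) hom_comp_family_ext
        lin3_proportional[of \<beta> l \<gamma> b, OF \<beta>] \<Gamma> A ..
    also have "\<dots> = (D * D * t2 * (t4 * t3), D * D * t2 * ((?c * t3 + ?b * (t2 * t1)) * t4),
        D * D * t2 * (t3 * (const3 l * t4 + const3 b * (t3 * t2))))"
    proof -
      have "const3 l * (D * t4) + const3 b * (D * (t3 * t2)) =
          D * (const3 l * t4 + const3 b * (t3 * t2))"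
        by (simp add: algebra_simps)
      thus ?thesis
        by (simp add: mult_ac)
    qed
    finally have "hom_iter ?F (Suc (Suc n)) =
      (D * D * t2 * ?P (Suc n), D * D * t2 * ?Q (Suc n), D * D * t2 * ?R (Suc n))"
      unfolding t .
    moreover have "D * D * t2 \<noteq> 0"
      using D(1) denom_nonzero[of b \<gamma> \<alpha>, OF nz] by (simp add: t)
    ultimately show ?case
      by blast
  qed
  then obtain D where D: "D \<noteq> 0" "hom_iter ?F (Suc n) = (D * ?P n, D * ?Q n, D * ?R n)"
    by blast
  define t0 t1 t2 t3 where t: "t0 = ?t n" "t1 = ?t (Suc n)" "t2 = ?t (Suc (Suc n))"
    "t3 = ?t (Suc (Suc (Suc n)))"
  define d0 d1 d2 d3 where d: "d0 = denom_degree n" "d1 = denom_degree (Suc n)"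
    "d2 = denom_degree (Suc (Suc n))" "d3 = denom_degree (Suc (Suc (Suc n)))"
  have h: "homogeneous3 d0 t0" "homogeneous3 d1 t1" "homogeneous3 d2 t2" "homogeneous3 d3 t3"
    unfolding t d by (rule denom_homogeneous)+
  have dd: "d2 = d1 + d0" "d3 = d2 + d1"
    unfolding d by (rule denom_degree_rec)+
  have "homogeneous3 (d3 + d2) (t3 * t2)"
    by (intro homogeneous3_mult h)
  moreover have "homogeneous3 (d2 + d3) ((?c * t2 + ?b * (t1 * t0)) * t3)"
    using homogeneous3_mult[OF h(2,1)] h
    by (intro homogeneous3_mult homogeneous3_add homogeneous3_const_mult) (auto simp: dd)
  moreover have "homogeneous3 (d2 + d3) (t2 * (const3 l * t3 + const3 b * (t2 * t1)))"
    using homogeneous3_mult[OF h(3,2)] h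
    by (intro homogeneous3_mult homogeneous3_add homogeneous3_const_mult) (auto simp: dd)
  moreover have "\<not> (\<pi> dvd t3 * t2 \<and> \<pi> dvd (?c * t2 + ?b * (t1 * t0)) * t3 \<and>
      \<pi> dvd t2 * (const3 l * t3 + const3 b * (t2 * t1)))" if \<pi>: "prime_elem \<pi>" for \<pi>
  proof safe
    assume dvd: "\<pi> dvd t3 * t2" "\<pi> dvd (?c * t2 + ?b * (t1 * t0)) * t3"
      "\<pi> dvd t2 * (const3 l * t3 + const3 b * (t2 * t1))"
    have cop: "\<not> (\<pi> dvd t2 \<and> \<pi> dvd t3)" "\<not> (\<pi> dvd t1 \<and> \<pi> dvd t2)"
      "\<not> (\<pi> dvd t1 \<and> \<pi> dvd t3)" "\<not> (\<pi> dvd t0 \<and> \<pi> dvd t2)"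
      using denom_coprime[of b \<gamma> \<alpha>, OF nz] \<pi> unfolding no_common_prime_def t by blast+
    consider "\<pi> dvd t3" | "\<pi> dvd t2"
      using dvd(1) \<pi> by (auto simp: prime_elem_dvd_mult_iff)
    thus False
    proof cases
      case 1
      hence "\<pi> dvd const3 l * t3 + const3 b * (t2 * t1)"
        using dvd(3) cop \<pi> by (auto simp: prime_elem_dvd_mult_iff)
      hence "\<pi> dvd const3 b * (t2 * t1)"
        using 1 by (simp add: dvd_add_right_iff)
      hence "\<pi> dvd t2 * t1"
        by (rule prime_elem_dvd_const3_mult[OF nz(1)])
      thus False
        using 1 cop \<pi> by (auto simp: prime_elem_dvd_mult_iff)
    next
      case 2
      hence "\<pi> dvd ?c * t2 + ?b * (t1 * t0)"
        using dvd(2) cop \<pi> by (metis prime_elem_dvd_mult_iff)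
      moreover have "\<pi> dvd ?c * t2"
        using 2 by simp
      ultimately have "\<pi> dvd ?b * (t1 * t0)"
        by (metis dvd_add_right_iff)
      hence "\<pi> dvd t1 * t0"
        by (rule prime_elem_dvd_const3_mult[of "\<alpha> 2 * b", rotated]) (use nz in simp)
      thus False
        using 2 cop \<pi> by (auto simp: prime_elem_dvd_mult_iff)
    qed
  qed
  ultimately have "hom_degree (D * (t3 * t2), D * ((?c * t2 + ?b * (t1 * t0)) * t3),
      D * (t2 * (const3 l * t3 + const3 b * (t2 * t1)))) = d2 + d3"
    by (intro hom_degree_eq D(1)) (auto simp: add.commute)
  moreover have "d2 + d3 = fib (Suc (Suc (Suc n)))"
    by (simp add: d denom_degree_def)
  ultimately show ?thesis
    unfolding D(2) t by simp
qed

section \<open>Positive entropy\<close>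

lemma dynamical_degree_eqI:
  assumes "(\<lambda>n. root n (real (hom_degree (hom_iter F n)))) \<longlonglongrightarrow> g"
  shows "dynamical_degree F = g"
  unfolding dynamical_degree_def by (rule limI[OF assms])

lemma fib_root_limit: "(\<lambda>n. root n (real (fib (Suc (Suc n))))) \<longlonglongrightarrow> (1 + sqrt 5) / 2"
proof -
  define g :: real where "g = (1 + sqrt 5) / 2"
  have g2: "g * g = g + 1"
    by (simp add: g_def field_simps)
  have g1: "g > 1"
    by (simp add: g_def)
  have g2': "g \<le> 2"
    using real_sqrt_le_mono[of 5 9] by (simp add: g_def)
  have bounds: "g ^ n \<le> real (fib (Suc (Suc n))) \<and> real (fib (Suc (Suc n))) \<le> g * g ^ n" for n
  proof (induction n rule: fib.induct)
    case 1
    thus ?case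
      using g1 by simp
  next
    case 2
    thus ?case
      using g1 g2 g2' by (simp add: numeral_eq_Suc)
  next
    case (3 n)
    have "g ^ Suc (Suc n) = g ^ Suc n + g ^ n"
      using g2 by (simp add: algebra_simps flip: mult.assoc)
    thus ?case
      using 3 by (simp add: algebra_simps)
  qed
  have upper: "(\<lambda>n. g * root n g) \<longlonglongrightarrow> g"
    using tendsto_mult_left[OF LIMSEQ_root_const[of g], of g] g1 by simp
  have "\<forall>\<^sub>F n in sequentially. g \<le> root n (real (fib (Suc (Suc n))))"
    using eventually_gt_at_top[of 0]
  proof eventually_elim
    case (elim n)
    hence "g = root n (g ^ n)"
      using g1 by (simp add: real_root_power_cancel)
    also have "\<dots> \<le> root n (real (fib (Suc (Suc n))))"
      using elim bounds by simp
    finally show ?case .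
  qed
  moreover have "\<forall>\<^sub>F n in sequentially. root n (real (fib (Suc (Suc n)))) \<le> g * root n g"
    using eventually_gt_at_top[of 0]
  proof eventually_elim
    case (elim n)
    hence "root n (real (fib (Suc (Suc n)))) \<le> root n (g * g ^ n)"
      using bounds by simp
    also have "\<dots> = g * root n g"
      using elim g1 by (simp add: real_root_mult real_root_power_cancel)
    finally show ?case .
  qed
  ultimately show ?thesis
    unfolding g_def[symmetric] by (rule tendsto_sandwich[OF _ _ tendsto_const upper])
qed

lemma entropy_nonzero:
  assumes \<beta>: "\<beta> 1 = l * \<gamma> 1" "\<beta> 2 = l * \<gamma> 2" "\<beta> 0 = l * \<gamma> 0 + b"
    and nz: "b \<noteq> 0" "\<gamma> 1 \<noteq> 0" "\<gamma> 2 \<noteq> 0" "\<alpha> 2 \<noteq> 0"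
  shows "algebraic_entropy (family_ext \<alpha> \<beta> \<gamma>) > 0"
proof -
  let ?F = "family_ext \<alpha> \<beta> \<gamma>"
  have "dynamical_degree ?F > 1"
  proof (cases "\<alpha> 1 = 0")
    case True
    have "\<forall>\<^sub>F n in sequentially. root n (real (fib (Suc (Suc n)))) =
        root n (real (hom_degree (hom_iter ?F n)))"
      using eventually_gt_at_top[of 0]
    proof eventually_elim
      case (elim n)
      then obtain m where "n = Suc m"
        by (cases n) auto
      thus ?case
        by (simp only: hom_degree_fibonacci[of \<beta> l \<gamma> b \<alpha>, OF \<beta> nz True])
    qed
    with fib_root_limit
    have "(\<lambda>n. root n (real (hom_degree (hom_iter ?F n)))) \<longlonglongrightarrow> (1 + sqrt 5) / 2"
      by (rule Lim_transform_eventually)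
    hence "dynamical_degree ?F = (1 + sqrt 5) / 2"
      by (rule dynamical_degree_eqI)
    moreover have "(1 + sqrt 5) / 2 > 1"
      by simp
    ultimately show ?thesis
      by (simp only:)
  next
    case False
    have "\<forall>\<^sub>F n in sequentially. 2 = root n (real (hom_degree (hom_iter ?F n)))"
      using eventually_gt_at_top[of 0]
    proof eventually_elim
      case (elim n)
      thus ?case
        using hom_degree_doubling[of \<beta> l \<gamma> b \<alpha>, OF \<beta> nz(1-3) False nz(4)]
        by (simp add: real_root_power_cancel)
    qed
    with tendsto_const have "(\<lambda>n. root n (real (hom_degree (hom_iter ?F n)))) \<longlonglongrightarrow> 2"
      by (rule Lim_transform_eventually)
    from dynamical_degree_eqI[OF this] show ?thesis
      by simp
  qed
  thus ?thesis
    by (simp add: algebraic_entropy_def)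
qed

section \<open>The normal form\<close>

lemma eval2_affine_form:
  "affine_form a z = eval2 [:[:a 0, a 1:], [:a 2:]:] z"
  by (cases z) (simp add: affine_form_def algebra_simps)

text \<open>
  A right inverse off a curve makes the image dense. Two values are allowed because a quotient that is
  constant where it is defined also takes the value \<open>0\<close> on the zero set of its denominator.
\<close>

lemma birational_components_not_two_valued:
  assumes "birational f"
  shows "\<not> (\<forall>z. fst (f z) = c \<or> fst (f z) = d)" and "\<not> (\<forall>z. snd (f z) = c \<or> snd (f z) = d)"
proof -
  from assms obtain C g where "algebraic_curve C" and g: "\<And>z. z \<notin> C \<Longrightarrow> f (g z) = z"
    unfolding birational_def by blast
  then obtain R where R: "R \<noteq> 0" "\<And>z. eval2 R z \<noteq> 0 \<Longrightarrow> f (g z) = z"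
    unfolding algebraic_curve_def by blast
  have nz: "\<exists>z. eval2 (R * S) z \<noteq> 0" if "S \<noteq> 0" for S
    using eval2_eqI[of "R * S" 0] R(1) that by auto
  show "\<not> (\<forall>z. fst (f z) = c \<or> fst (f z) = d)"
  proof
    assume *: "\<forall>z. fst (f z) = c \<or> fst (f z) = d"
    obtain z where z: "eval2 (R * [:[:- c, 1:] * [:- d, 1:]:]) z \<noteq> 0"
      using nz[of "[:[:- c, 1:] * [:- d, 1:]:]"] by auto
    have "fst z = c \<or> fst z = d"
      using *[rule_format, of "g z"] R(2)[of z] z by auto
    with z show False
      by auto
  qed
  show "\<not> (\<forall>z. snd (f z) = c \<or> snd (f z) = d)"
  proof
    assume *: "\<forall>z. snd (f z) = c \<or> snd (f z) = d"
    obtain z where z: "eval2 (R * ([:[:- c:], 1:] * [:[:- d:], 1:])) z \<noteq> 0"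
      using nz[of "[:[:- c:], 1:] * [:[:- d:], 1:]"] by (auto simp del: mult_pCons_left mult_pCons_right)
    hence "eval2 R z \<noteq> 0" "snd z \<noteq> c" "snd z \<noteq> d"
      by (auto simp del: mult_pCons_left mult_pCons_right)
    thus False
      using *[rule_format, of "g z"] R(2)[of z] by simp
  qed
qed

text \<open>
  The new coordinates are \<open>y - l\<close> and the affine function of \<open>x\<close> whose sum with \<open>y - l\<close> is
  \<open>(\<gamma>\<^sub>0 + \<gamma>\<^sub>1 x + \<gamma>\<^sub>2 y) / \<gamma>\<^sub>2\<close>.
\<close>

lemma triangular_normal_form:
  assumes \<beta>: "\<beta> 1 = l * \<gamma> 1" "\<beta> 2 = l * \<gamma> 2" "\<beta> 0 = l * \<gamma> 0 + b"
    and nz: "\<gamma> 1 \<noteq> 0" "\<gamma> 2 \<noteq> 0" and "\<alpha> 2 = 0"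
  shows "\<exists>\<alpha>0 \<beta>0 h. affinely_conjugate_by h (family_map \<alpha> \<beta> \<gamma>) (normal_form \<alpha>0 (\<alpha> 1) \<beta>0)"
proof -
  define e where "e = \<gamma> 0 / \<gamma> 2 + l"
  define h where "h = (\<lambda>(x, y). (e + \<gamma> 1 / \<gamma> 2 * x + 0 * y, - l + 0 * x + 1 * y))"
  define \<alpha>0 where "\<alpha>0 = e + \<gamma> 1 / \<gamma> 2 * \<alpha> 0 - \<alpha> 1 * e"
  have "\<gamma> 1 / \<gamma> 2 * 1 - 0 * 0 \<noteq> 0"
    using nz by simp
  hence "affine_change h"
    unfolding affine_change_def h_def by blast
  moreover have "eq_off_curve (h \<circ> family_map \<alpha> \<beta> \<gamma>) (normal_form \<alpha>0 (\<alpha> 1) (b / \<gamma> 2) \<circ> h)"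
  proof (rule eq_off_curveI)
    show "[:[:\<gamma> 0, \<gamma> 1:], [:\<gamma> 2:]:] \<noteq> 0"
      using nz by simp
    fix z assume "eval2 [:[:\<gamma> 0, \<gamma> 1:], [:\<gamma> 2:]:] z \<noteq> 0"
    hence \<gamma>: "affine_form \<gamma> z \<noteq> 0"
      by (simp only: eval2_affine_form not_False_eq_True)
    obtain x y where z: "z = (x, y)"
      by (cases z)
    have "affine_form \<beta> z = l * affine_form \<gamma> z + b"
      using \<beta> by (simp add: affine_form_def z algebra_simps)
    hence second: "affine_form \<beta> z / affine_form \<gamma> z = l + b / affine_form \<gamma> z"
      using \<gamma> by (simp add: add_divide_distrib)
    have "(e + \<gamma> 1 / \<gamma> 2 * x) + (y - l) = affine_form \<gamma> z / \<gamma> 2"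
      using nz by (simp add: e_def affine_form_def z add_divide_distrib)
    hence "b / \<gamma> 2 / ((e + \<gamma> 1 / \<gamma> 2 * x) + (y - l)) = b / affine_form \<gamma> z"
      using nz by (simp only: divide_divide_eq_right divide_divide_eq_left) simp
    moreover have "e + \<gamma> 1 / \<gamma> 2 * (\<alpha> 0 + \<alpha> 1 * x) = \<alpha>0 + \<alpha> 1 * (e + \<gamma> 1 / \<gamma> 2 * x)"
      unfolding \<alpha>0_def by algebra
    moreover have "affine_form \<alpha> z = \<alpha> 0 + \<alpha> 1 * x"
      using \<open>\<alpha> 2 = 0\<close> by (simp add: affine_form_def z)
    moreover have h: "h (u, v) = (e + \<gamma> 1 / \<gamma> 2 * u, v - l)" for u v
      by (simp add: h_def)
    ultimately show "(h \<circ> family_map \<alpha> \<beta> \<gamma>) z = (normal_form \<alpha>0 (\<alpha> 1) (b / \<gamma> 2) \<circ> h) z"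
      using second by (simp only: o_apply z h family_map_def normal_form_def prod.case)
        (simp only: add_diff_cancel_left')
  qed
  ultimately show ?thesis
    unfolding affinely_conjugate_by_def by blast
qed

lemma zero_entropy_normal_form:
  assumes "birational (family_map \<alpha> \<beta> \<gamma>)"
    and "\<beta> 1 * \<gamma> 2 - \<beta> 2 * \<gamma> 1 = 0" and "\<gamma> 1 * \<gamma> 2 \<noteq> 0"
    and "algebraic_entropy (family_ext \<alpha> \<beta> \<gamma>) = 0"
  shows "\<exists>\<alpha>0 \<alpha>1 \<beta>0 h. \<alpha>1 \<noteq> 0 \<and>
           affinely_conjugate_by h (family_map \<alpha> \<beta> \<gamma>) (normal_form \<alpha>0 \<alpha>1 \<beta>0)"
proof -
  define l where "l = \<beta> 1 / \<gamma> 1"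
  define b where "b = \<beta> 0 - l * \<gamma> 0"
  have nz: "\<gamma> 1 \<noteq> 0" "\<gamma> 2 \<noteq> 0"
    using assms(3) by auto
  have \<beta>: "\<beta> 1 = l * \<gamma> 1" "\<beta> 2 = l * \<gamma> 2" "\<beta> 0 = l * \<gamma> 0 + b"
    using assms(2) nz by (auto simp: l_def b_def field_simps)
  have "b \<noteq> 0"
  proof
    assume "b = 0"
    hence "affine_form \<beta> z = l * affine_form \<gamma> z" for z
      using \<beta> by (cases z) (simp add: affine_form_def algebra_simps)
    hence "\<forall>z. snd (family_map \<alpha> \<beta> \<gamma> z) = l \<or> snd (family_map \<alpha> \<beta> \<gamma> z) = 0"
      by (simp add: family_map_def)
    thus False
      using birational_components_not_two_valued(2)[OF assms(1)] by blast
  qed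
  have "\<alpha> 2 = 0"
  proof (rule ccontr)
    assume "\<alpha> 2 \<noteq> 0"
    from entropy_nonzero[of \<beta> l \<gamma> b \<alpha>, OF \<beta> \<open>b \<noteq> 0\<close> nz this] assms(4) show False
      by simp
  qed
  moreover have "\<alpha> 1 \<noteq> 0"
  proof
    assume "\<alpha> 1 = 0"
    hence "\<forall>z. fst (family_map \<alpha> \<beta> \<gamma> z) = \<alpha> 0 \<or> fst (family_map \<alpha> \<beta> \<gamma> z) = \<alpha> 0"
      using \<open>\<alpha> 2 = 0\<close> by (simp add: family_map_def affine_form_def case_prod_beta)
    thus False
      using birational_components_not_two_valued(1)[OF assms(1)] by blast
  qed
  ultimately show ?thesis
    using triangular_normal_form[of \<beta> l \<gamma> b \<alpha>, OF \<beta> nz] by blast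
qed

theorem proposition7:
  fixes \<alpha> \<beta> \<gamma> :: "nat \<Rightarrow> complex"
  assumes "(\<gamma> 1, \<gamma> 2) \<noteq> (0, 0)"
    and "birational (family_map \<alpha> \<beta> \<gamma>)"
    and "\<beta> 1 * \<gamma> 2 - \<beta> 2 * \<gamma> 1 = 0"
    and "\<gamma> 1 * \<gamma> 2 \<noteq> 0"
    and "algebraic_entropy (family_ext \<alpha> \<beta> \<gamma>) = 0"
  shows "(\<exists>\<alpha>0 \<alpha>1 \<beta>0 h. \<alpha>1 \<noteq> 0 \<and>
            affinely_conjugate_by h (family_map \<alpha> \<beta> \<gamma>) (normal_form \<alpha>0 \<alpha>1 \<beta>0)) \<and>
         (\<forall>\<alpha>0 \<alpha>1 \<beta>0 h. \<alpha>1 \<noteq> 0 \<longrightarrow>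
            affinely_conjugate_by h (family_map \<alpha> \<beta> \<gamma>) (normal_form \<alpha>0 \<alpha>1 \<beta>0) \<longrightarrow>
              preserves_fibration (normal_form \<alpha>0 \<alpha>1 \<beta>0) (\<lambda>(x, y). x) \<and>
              (\<forall>V. preserves_fibration (normal_form \<alpha>0 \<alpha>1 \<beta>0) V \<longrightarrow>
                   same_fibration V (\<lambda>(x, y). x)) \<and>
              (\<forall>p>1. \<alpha>1 ^ p = 1 \<and> \<alpha>1 \<noteq> 1 \<longrightarrow>
                   first_integral (normal_form \<alpha>0 \<alpha>1 \<beta>0)
                     (\<lambda>(x, y). \<Prod>j<p. ((\<lambda>u. \<alpha>0 + \<alpha>1 * u) ^^ j) x)) \<and>
              (\<alpha>1 = 1 \<and> \<alpha>0 = 0 \<longrightarrow> integrable_map (normal_form \<alpha>0 \<alpha>1 \<beta>0)))"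
proof (intro conjI allI impI)
  show "\<exists>\<alpha>0 \<alpha>1 \<beta>0 h. \<alpha>1 \<noteq> 0 \<and>
      affinely_conjugate_by h (family_map \<alpha> \<beta> \<gamma>) (normal_form \<alpha>0 \<alpha>1 \<beta>0)"
    using assms(2-5) by (rule zero_entropy_normal_form)
next
  fix \<alpha>0 \<alpha>1 \<beta>0 :: complex
  assume "\<alpha>1 \<noteq> 0"
  thus "preserves_fibration (normal_form \<alpha>0 \<alpha>1 \<beta>0) (\<lambda>(x, y). x)"
    by (rule normal_form_preserves_vertical)
next
  fix \<alpha>0 \<alpha>1 \<beta>0 :: complex and V
  assume "\<alpha>1 \<noteq> 0" "preserves_fibration (normal_form \<alpha>0 \<alpha>1 \<beta>0) V"
  thus "same_fibration V (\<lambda>(x, y). x)"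
    by (rule preserved_fibration_vertical)
next
  fix \<alpha>0 \<alpha>1 \<beta>0 :: complex and p :: nat
  assume "p > 1" "\<alpha>1 ^ p = 1 \<and> \<alpha>1 \<noteq> 1"
  thus "first_integral (normal_form \<alpha>0 \<alpha>1 \<beta>0)
      (\<lambda>(x, y). \<Prod>j<p. ((\<lambda>u. \<alpha>0 + \<alpha>1 * u) ^^ j) x)"
    using orbit_product_first_integral by blast
next
  fix \<alpha>0 \<alpha>1 \<beta>0 :: complex
  assume "\<alpha>1 = 1 \<and> \<alpha>0 = 0"
  thus "integrable_map (normal_form \<alpha>0 \<alpha>1 \<beta>0)"
    using integrable_vertical_translation_free by simp
qed

end
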